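(* Let $\lambda\in\mathbf{k}$ be fixed, let $(X,\leq)$ be a well-ordered set and let $\leq_{\rm PL_r}$ be the right path-lexicographical order on the set $\mathfrak{S}(X)$ of nonunitary bracketed words on $X$ (defined in the context). (a) The set $$S_{\rm rbr}:=\big\{\lfloor x\lfloor y\rfloor\rfloor+\lfloor\lfloor x\rfloor y\rfloor+\lambda\lfloor xy\rfloor-\lfloor x\rfloor\lfloor y\rfloor\ \big|\ x,y\in\mathfrak{S}(X)\big\}$$ is a Gröbner-Shirshov basis in $\mathbf{k}\mathfrak{S}(X)$ with respect to $\leq_{\rm PL_r}$. (b) The set $$\mathrm{Irr}(S_{\rm rbr}):=\mathfrak{S}(X)\setminus\big\{q|_{\lfloor x\lfloor y\rfloor\rfloor}\ \big|\ x,y\in\mathfrak{S}(X),\ q\in\mathfrak{S}^\star(X)\big\}$$ is (via its image in the quotient) a $\mathbf{k}$-basis of the free nonunitary Rota-Baxter algebra $\mathbf{k}\mathfrak{S}(X)/\mathrm{Id}(S_{\rm rbr})$ (of weight $\lambda$) on $X$.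
   Context: $\mathbf{k}$ is a unitary commutative ring of characteristic zero; nonunitary algebras are associative, not necessarily commutative $\mathbf{k}$-algebras, not required to have a unit. A nonunitary Rota-Baxter algebra of weight $\lambda$ is a nonunitary algebra $A$ with a linear operator $P:A\to A$ such that $P(x)P(y)=P(P(x)y)+P(xP(y))+\lambda P(xy)$ for all $x,y\in A$. Nonunitary bracketed words. For a set $Y$, let $\mathrm{Sg}(Y)$ be the free semigroup on $Y$ (nonempty words). Put $\mathfrak{S}_0(X)=\mathrm{Sg}(X)$ and $\mathfrak{S}_n(X)=\mathrm{Sg}(X\sqcup\lfloor\mathfrak{S}_{n-1}(X)\rfloor)$ for $n\ge1$, where $\lfloor Y\rfloor=\{\lfloor u\rfloor\mid u\in Y\}$ is a disjoint copy of $Y$; with the natural embeddings, $\mathfrak{S}(X)=\bigcup_{n\ge0}\mathfrak{S}_n(X)$. Each $w\in\mathfrak{S}(X)$ is uniquely $w=w_1\cdots w_k$, $k\ge1$, with $w_i\in X\sqcup\lfloor\mathfrak{S}(X)\rfloor$ (prime elements); $|w|=k$ is the breadth. $\mathbf{k}\mathfrak{S}(X)$ is the free module on $\mathfrak{S}(X)$, a nonunitary algebra with the linear operator extending $w\mapsto\lfloor w\rfloor$. $\mathrm{Id}(S)$ is the operated ideal generated by $S$ (smallest ideal containing $S$ and closed under $\lfloor\ \rfloor$); quotients carry the induced operator. $\star$-bracketed words. For a symbol $\star\notin X$, $\mathfrak{S}^\star(X)$ is the set of elements of $\mathfrak{S}(X\sqcup\{\star\})$ in which $\star$ occurs exactly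 once; $q|_u$ replaces $\star$ in $q$ by $u\in\mathfrak{S}(X)$, and $q|_s=\sum_ic_iq|_{u_i}$ for $s=\sum_ic_iu_i\in\mathbf{k}\mathfrak{S}(X)$. Order. $\deg(w)$ is the total number of occurrences in $w$ of letters of $X$. Let $P,\mu$ be two symbols not in $X$, and $M(X\sqcup\{P,\mu\})$ the free monoid. If $x_1,\dots,x_k$ are the occurrences of letters of $X$ in $w$ from left to right, define $\mathrm{Path}_w(x_i)\in M(X\sqcup\{P,\mu\})$ recursively: if $w=x_i\in X$, it is $x_i$; if $w=\lfloor w'\rfloor$, it is $P\,\mathrm{Path}_{w'}(x_i)$; if $w=w_1\cdots w_n$ with $n\ge2$, $w_j$ prime, and the occurrence $x_i$ lies in $w_j$, it is $\mu\,\mathrm{Path}_{w_j}(x_i)$. Put $\mathrm{Path}_{\rm r}(w)=(\mathrm{Path}_w(x_k),\mathrm{Path}_w(x_{k-1}),\dots,\mathrm{Path}_w(x_1))$. Extend the order of $X$ to $X\sqcup\{P,\mu\}$ by $x<P<\mu$ for all $x\in X$ and order $M(X\sqcup\{P,\mu\})$ by the degree lexicographical order (length first, then lexicographically from the left). Define $u\leq_{\rm PL_r}v$ iff $(\deg(u),\mathrm{Path}_{\rm r}(u))\leq(\deg(v),\mathrm{Path}_{\rm r}(v))$ lexicographically, individual paths being compared by the degree lexicographical order. Gröbner-Shirshov bases. With respect to the order, $\overline{s}$ denotes the leading (largest) monomial of $0\ne s\in\mathbf{k}\mathfrak{S}(X)$; $s$ is monic if $\overline{s}$ has coefficient $1$.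 Let $f,g$ be monic. If $w=\overline fu=v\overline g$ with $u,v,w\in\mathfrak{S}(X)$ and $\max\{|\overline f|,|\overline g|\}<|w|<|\overline f|+|\overline g|$, then $fu-vg$ is an intersection composition with respect to $w$. If $w=\overline f=q|_{\overline g}$ with $q\in\mathfrak{S}^\star(X)$, then $f-q|_g$ is an including composition with respect to $w$. An element $h$ is trivial modulo $(S,w)$ if $h=\sum_ic_iq_i|_{s_i}$ with $c_i\in\mathbf{k}$, $q_i\in\mathfrak{S}^\star(X)$, $s_i\in S$ and $\overline{q_i|_{s_i}}<w$. A monic set $S$ is a Gröbner-Shirshov basis if all intersection and including compositions (with respect to $w$) of pairs in $S$ are trivial modulo $(S,w)$. *)

theory Defs
  imports
    "HOL-Library.Poly_Mapping"
    "HOL-Algebra.Module"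
    "HOL-Algebra.QuotRing"
    "HOL-Algebra.Algebraic_Closure_Type"
begin

section \<open>Bracketed words\<close>

text \<open>
  A nonunitary bracketed word is a nonempty sequence of primes, a prime being a letter or a
  bracketed word put in brackets. The initial algebra of this signature is the union of the
  stages of the usual construction by iterated free semigroups; \<open>Prime p\<close> is the word of
  breadth 1 and \<open>Mult p w\<close> the word \<open>w\<close> with the further prime \<open>p\<close> in front.
\<close>

datatype 'x bword = Prime "'x bprime" | Mult "'x bprime" "'x bword"
  and 'x bprime = Letter 'x | Bracket "'x bword"

primrec conc :: "'x bword \<Rightarrow> 'x bword \<Rightarrow> 'x bword" (infixr \<open>\<cdot>\<close> 75) where
  "Prime p \<cdot> v = Mult p v"
| "Mult p u \<cdot> v = Mult p (u \<cdot> v)"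

abbreviation bracket :: "'x bword \<Rightarrow> 'x bword" (\<open>\<lfloor>_\<rfloor>\<^sub>B\<close>) where
  "\<lfloor>w\<rfloor>\<^sub>B \<equiv> Prime (Bracket w)"

primrec primes_of :: "'x bword \<Rightarrow> 'x bprime list" where
  "primes_of (Prime p) = [p]"
| "primes_of (Mult p w) = p # primes_of w"

definition breadth :: "'x bword \<Rightarrow> nat" where
  "breadth w = length (primes_of w)"

primrec letters :: "'x bword \<Rightarrow> 'x list" and prime_letters :: "'x bprime \<Rightarrow> 'x list" where
  "letters (Prime p) = prime_letters p"
| "letters (Mult p w) = prime_letters p @ letters w"
| "prime_letters (Letter x) = [x]"
| "prime_letters (Bracket w) = letters w"

definition bdeg :: "'x bword \<Rightarrow> nat" where
  "bdeg w = length (letters w)"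

text \<open>The symbol \<open>\<star>\<close> is \<open>None\<close>, and \<open>'x option\<close> is the alphabet extended by it.\<close>

definition star_words :: "'x option bword set" where
  "star_words = {q. count_list (letters q) None = 1}"

primrec subst_star :: "'x option bword \<Rightarrow> 'x bword \<Rightarrow> 'x bword"
  and subst_star_prime :: "'x option bprime \<Rightarrow> 'x bword \<Rightarrow> 'x bword" where
  "subst_star (Prime p) u = subst_star_prime p u"
| "subst_star (Mult p q) u = subst_star_prime p u \<cdot> subst_star q u"
| "subst_star_prime (Letter a) u = (case a of None \<Rightarrow> u | Some x \<Rightarrow> Prime (Letter x))"
| "subst_star_prime (Bracket q) u = \<lfloor>subst_star q u\<rfloor>\<^sub>B"

section \<open>The right path-lexicographical order\<close>

datatype 'x path_symbol = PLetter 'x | PP | PMu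

definition path_symbol_less :: "('x::wellorder path_symbol \<times> 'x path_symbol) set" where
  "path_symbol_less =
     {(PLetter x, PLetter y) | x y. x < y} \<union> {(PLetter x, PP) | x. True}
     \<union> {(PLetter x, PMu) | x. True} \<union> {(PP, PMu)}"

lemma size_factor: "p \<in> set (primes_of w) \<Longrightarrow> size p < size w"
proof -
  have "p \<in> set (primes_of w) \<longrightarrow> size p < size w"
    by (rule bword.induct[of "\<lambda>_. True"]) auto
  then show "p \<in> set (primes_of w) \<Longrightarrow> size p < size w" by blast
qed

text \<open>
  \<open>paths w\<close> is the list of the paths of all occurrences of letters in \<open>w\<close>, taken from left to
  right.
\<close>

function paths :: "'x bword \<Rightarrow> 'x path_symbol list list"
  and prime_paths :: "'x bprime \<Rightarrow> 'x path_symbol list list" where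
  "paths w =
     (let ps = concat (map prime_paths (primes_of w))
      in if breadth w = 1 then ps else map (\<lambda>p. PMu # p) ps)"
| "prime_paths (Letter x) = [[PLetter x]]"
| "prime_paths (Bracket w) = map (\<lambda>p. PP # p) (paths w)"
  by pat_completeness auto
termination
  by (relation "measure (case_sum size size)") (auto simp: size_factor)

definition path_r :: "'x bword \<Rightarrow> 'x path_symbol list list" where
  "path_r w = rev (paths w)"

text \<open>
  Paths are compared by \<^term>\<open>lenlex path_symbol_less\<close>, the degree lexicographical order, and
  sequences of paths of equal length by \<^const>\<open>lex\<close>. Words of equal degree have sequences of
  paths of equal length. Note that \<open>plr_le\<close> compares words through their paths only and is not
  antisymmetric: \<open>\<lfloor>xx\<rfloor>\<lfloor>xxx\<rfloor>\<close> and \<open>\<lfloor>xxx\<rfloor>\<lfloor>xx\<rfloor>\<close> have the same paths.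
\<close>

definition plr_le :: "'x::wellorder bword \<Rightarrow> 'x bword \<Rightarrow> bool" where
  "plr_le u v \<longleftrightarrow>
     (bdeg u, path_r u) = (bdeg v, path_r v) \<or>
     ((bdeg u, path_r u), (bdeg v, path_r v)) \<in> less_than <*lex*> lex (lenlex path_symbol_less)"

section \<open>The free operated algebra\<close>

text \<open>
  The free module on the bracketed words is \<^typ>\<open>'x bword \<Rightarrow>\<^sub>0 'k\<close>, the type of functions of
  finite support.
\<close>

abbreviation basis_elem :: "'w \<Rightarrow> ('w \<Rightarrow>\<^sub>0 'k::comm_ring_1)" where
  "basis_elem w \<equiv> Poly_Mapping.single w 1"

definition scale :: "'k::comm_ring_1 \<Rightarrow> ('w \<Rightarrow>\<^sub>0 'k) \<Rightarrow> ('w \<Rightarrow>\<^sub>0 'k)" where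
  "scale c f = Poly_Mapping.map (\<lambda>a. c * a) f"

text \<open>\<open>lin_ext \<phi>\<close> is the linear map that sends each basis element \<open>u\<close> to \<open>\<phi> u\<close>.\<close>

definition lin_ext :: "('v \<Rightarrow> 'w) \<Rightarrow> ('v \<Rightarrow>\<^sub>0 'k::comm_ring_1) \<Rightarrow> ('w \<Rightarrow>\<^sub>0 'k)" where
  "lin_ext \<phi> f = (\<Sum>u\<in>Poly_Mapping.keys f. Poly_Mapping.single (\<phi> u) (Poly_Mapping.lookup f u))"

definition word_mult ::
    "('x bword \<Rightarrow>\<^sub>0 'k::comm_ring_1) \<Rightarrow> ('x bword \<Rightarrow>\<^sub>0 'k) \<Rightarrow> ('x bword \<Rightarrow>\<^sub>0 'k)" where
  "word_mult f g =
     (\<Sum>u\<in>Poly_Mapping.keys f. \<Sum>v\<in>Poly_Mapping.keys g. Poly_Mapping.single (u \<cdot> v) (Poly_Mapping.lookup f u * Poly_Mapping.lookup g v))"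

definition subst_star_lin ::
    "'x option bword \<Rightarrow> ('x bword \<Rightarrow>\<^sub>0 'k::comm_ring_1) \<Rightarrow> ('x bword \<Rightarrow>\<^sub>0 'k)" where
  "subst_star_lin q s = lin_ext (subst_star q) s"

section \<open>Groebner-Shirshov bases\<close>

text \<open>
  Everything below is relative to a relation \<open>leq\<close> on words. As \<open>leq\<close> need not be
  antisymmetric, strict comparison is its strict part, and a leading monomial has to be strictly
  larger than all the other monomials.
\<close>

definition strict :: "('w \<Rightarrow> 'w \<Rightarrow> bool) \<Rightarrow> 'w \<Rightarrow> 'w \<Rightarrow> bool" where
  "strict leq u v \<longleftrightarrow> leq u v \<and> \<not> leq v u"

definition lead :: "('w \<Rightarrow> 'w \<Rightarrow> bool) \<Rightarrow> ('w \<Rightarrow>\<^sub>0 'k::comm_ring_1) \<Rightarrow> 'w" where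
  "lead leq s = (THE m. m \<in> Poly_Mapping.keys s \<and> (\<forall>m'\<in>Poly_Mapping.keys s. m' \<noteq> m \<longrightarrow> strict leq m' m))"

definition monic :: "('w \<Rightarrow> 'w \<Rightarrow> bool) \<Rightarrow> ('w \<Rightarrow>\<^sub>0 'k::comm_ring_1) \<Rightarrow> bool" where
  "monic leq s \<longleftrightarrow> s \<noteq> 0 \<and> Poly_Mapping.lookup s (lead leq s) = 1"

definition trivial_mod :: "('x bword \<Rightarrow> 'x bword \<Rightarrow> bool) \<Rightarrow>
    ('x bword \<Rightarrow>\<^sub>0 'k::comm_ring_1) set \<Rightarrow> 'x bword \<Rightarrow> ('x bword \<Rightarrow>\<^sub>0 'k) \<Rightarrow> bool" where
  "trivial_mod leq S w h \<longleftrightarrow>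
     (\<exists>ts. h = (\<Sum>(c, q, s)\<leftarrow>ts. scale c (subst_star_lin q s)) \<and>
           (\<forall>(c, q, s)\<in>set ts.
              q \<in> star_words \<and> s \<in> S \<and> strict leq (lead leq (subst_star_lin q s)) w))"

definition intersection_compositions :: "('x bword \<Rightarrow> 'x bword \<Rightarrow> bool) \<Rightarrow>
    ('x bword \<Rightarrow>\<^sub>0 'k::comm_ring_1) \<Rightarrow> ('x bword \<Rightarrow>\<^sub>0 'k) \<Rightarrow> ('x bword \<times> ('x bword \<Rightarrow>\<^sub>0 'k)) set" where
  "intersection_compositions leq f g =
     {(w, word_mult f (basis_elem u) - word_mult (basis_elem v) g) | u v w.
        w = lead leq f \<cdot> u \<and> w = v \<cdot> lead leq g \<and>
        max (breadth (lead leq f)) (breadth (lead leq g)) < breadth w \<and>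
        breadth w < breadth (lead leq f) + breadth (lead leq g)}"

definition including_compositions :: "('x bword \<Rightarrow> 'x bword \<Rightarrow> bool) \<Rightarrow>
    ('x bword \<Rightarrow>\<^sub>0 'k::comm_ring_1) \<Rightarrow> ('x bword \<Rightarrow>\<^sub>0 'k) \<Rightarrow> ('x bword \<times> ('x bword \<Rightarrow>\<^sub>0 'k)) set" where
  "including_compositions leq f g =
     {(w, f - subst_star_lin q g) | q w.
        q \<in> star_words \<and> w = lead leq f \<and> w = subst_star q (lead leq g)}"

definition groebner_shirshov_basis ::
    "('x bword \<Rightarrow> 'x bword \<Rightarrow> bool) \<Rightarrow> ('x bword \<Rightarrow>\<^sub>0 'k::comm_ring_1) set \<Rightarrow> bool" where
  "groebner_shirshov_basis leq S \<longleftrightarrow>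
     (\<forall>f\<in>S. monic leq f) \<and>
     (\<forall>f\<in>S. \<forall>g\<in>S.
        \<forall>(w, h) \<in> intersection_compositions leq f g \<union> including_compositions leq f g.
          trivial_mod leq S w h)"

section \<open>Nonunitary operated algebras and Rota-Baxter algebras\<close>

text \<open>
  The record inherits the field \<open>one\<close> from rings; no assumption is ever made on it, so that the
  algebras are nonunitary. Scalars are taken from a type of class \<^class>\<open>comm_ring_1\<close>, viewed as
  a ring with carrier by \<^const>\<open>ring_of_type_algebra\<close>.
\<close>

record ('k, 'a) operated_algebra = "('k, 'a) module" +
  oper :: "'a \<Rightarrow> 'a"

locale nonunitary_operated_algebra =
  Module.module "ring_of_type_algebra :: 'k ring" A
  for A :: "('k::comm_ring_1, 'a, 'm) operated_algebra_scheme" (structure) +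
  assumes mult_closed: "\<lbrakk>x \<in> carrier A; y \<in> carrier A\<rbrakk> \<Longrightarrow> x \<otimes> y \<in> carrier A"
    and mult_assoc:
      "\<lbrakk>x \<in> carrier A; y \<in> carrier A; z \<in> carrier A\<rbrakk> \<Longrightarrow> (x \<otimes> y) \<otimes> z = x \<otimes> (y \<otimes> z)"
    and mult_distr_left:
      "\<lbrakk>x \<in> carrier A; y \<in> carrier A; z \<in> carrier A\<rbrakk> \<Longrightarrow> (x \<oplus> y) \<otimes> z = x \<otimes> z \<oplus> y \<otimes> z"
    and mult_distr_right:
      "\<lbrakk>x \<in> carrier A; y \<in> carrier A; z \<in> carrier A\<rbrakk> \<Longrightarrow> z \<otimes> (x \<oplus> y) = z \<otimes> x \<oplus> z \<otimes> y"
    and smult_mult_left: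
      "\<lbrakk>x \<in> carrier A; y \<in> carrier A\<rbrakk> \<Longrightarrow> (c \<odot> x) \<otimes> y = c \<odot> (x \<otimes> y)"
    and smult_mult_right:
      "\<lbrakk>x \<in> carrier A; y \<in> carrier A\<rbrakk> \<Longrightarrow> x \<otimes> (c \<odot> y) = c \<odot> (x \<otimes> y)"
    and oper_closed: "x \<in> carrier A \<Longrightarrow> oper A x \<in> carrier A"
    and oper_add: "\<lbrakk>x \<in> carrier A; y \<in> carrier A\<rbrakk> \<Longrightarrow> oper A (x \<oplus> y) = oper A x \<oplus> oper A y"
    and oper_smult: "x \<in> carrier A \<Longrightarrow> oper A (c \<odot> x) = c \<odot> oper A x"

locale nonunitary_rota_baxter_algebra = nonunitary_operated_algebra A
  for lam :: "'k::comm_ring_1" and A :: "('k, 'a, 'm) operated_algebra_scheme" (structure) +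
  assumes rota_baxter: "\<lbrakk>x \<in> carrier A; y \<in> carrier A\<rbrakk> \<Longrightarrow>
    oper A x \<otimes> oper A y =
      oper A (oper A x \<otimes> y) \<oplus> oper A (x \<otimes> oper A y) \<oplus> lam \<odot> oper A (x \<otimes> y)"

definition operated_hom :: "('k, 'a, 'm) operated_algebra_scheme \<Rightarrow>
    ('k, 'b, 'n) operated_algebra_scheme \<Rightarrow> ('a \<Rightarrow> 'b) set" where
  "operated_hom A B =
     {h. h \<in> carrier A \<rightarrow> carrier B \<and>
         (\<forall>x\<in>carrier A. \<forall>y\<in>carrier A.
            h (x \<oplus>\<^bsub>A\<^esub> y) = h x \<oplus>\<^bsub>B\<^esub> h y \<and> h (x \<otimes>\<^bsub>A\<^esub> y) = h x \<otimes>\<^bsub>B\<^esub> h y) \<and>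
         (\<forall>c. \<forall>x\<in>carrier A. h (c \<odot>\<^bsub>A\<^esub> x) = c \<odot>\<^bsub>B\<^esub> h x) \<and>
         (\<forall>x\<in>carrier A. h (oper A x) = oper B (h x))}"

text \<open>
  \<open>A\<close> with the map \<open>i\<close> is free on the set of all elements of the type \<open>'x\<close>. HOL cannot quantify
  over types inside a formula, so the type \<open>'b\<close> in which the test algebras live is a parameter; a
  theorem in which \<open>'b\<close> is a type variable covers all of them.
\<close>

definition free_nonunitary_rota_baxter_algebra :: "'b itself \<Rightarrow> 'k::comm_ring_1 \<Rightarrow>
    ('k, 'a, 'm) operated_algebra_scheme \<Rightarrow> ('x \<Rightarrow> 'a) \<Rightarrow> bool" where
  "free_nonunitary_rota_baxter_algebra _ lam A i \<longleftrightarrow>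
     nonunitary_rota_baxter_algebra lam A \<and> (\<forall>x. i x \<in> carrier A) \<and>
     (\<forall>(B :: ('k, 'b) operated_algebra) f.
        nonunitary_rota_baxter_algebra lam B \<and> (\<forall>x. f x \<in> carrier B) \<longrightarrow>
        (\<exists>h \<in> operated_hom A B. (\<forall>x. h (i x) = f x) \<and>
           (\<forall>h' \<in> operated_hom A B. (\<forall>x. h' (i x) = f x) \<longrightarrow> (\<forall>a\<in>carrier A. h' a = h a))))"

definition operated_ideal :: "'a set \<Rightarrow> ('k::comm_ring_1, 'a, 'm) operated_algebra_scheme \<Rightarrow> bool" where
  "operated_ideal I A \<longleftrightarrow>
     submodule I (ring_of_type_algebra :: 'k ring) A \<and>
     (\<forall>x\<in>I. \<forall>a\<in>carrier A. x \<otimes>\<^bsub>A\<^esub> a \<in> I \<and> a \<otimes>\<^bsub>A\<^esub> x \<in> I) \<and>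
     (\<forall>x\<in>I. oper A x \<in> I)"

definition operated_ideal_gen ::
    "('k::comm_ring_1, 'a, 'm) operated_algebra_scheme \<Rightarrow> 'a set \<Rightarrow> 'a set" where
  "operated_ideal_gen A S = \<Inter>{I. operated_ideal I A \<and> S \<subseteq> I}"

text \<open>
  The first five fields are those of \<^const>\<open>FactRing\<close>; the other two apply the scalar
  multiplication and the operator to representatives, in the same manner as \<^const>\<open>rcoset_mult\<close>.
\<close>

definition quotient_operated_algebra ::
    "('k::comm_ring_1, 'a, 'm) operated_algebra_scheme \<Rightarrow> 'a set \<Rightarrow> ('k, 'a set) operated_algebra" where
  "quotient_operated_algebra A I =
     \<lparr>carrier = carrier (A Quot I), monoid.mult = monoid.mult (A Quot I), one = one (A Quot I),
      ring.zero = ring.zero (A Quot I), add = add (A Quot I),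
      module.smult = (\<lambda>c C. \<Union>a\<in>C. I +>\<^bsub>A\<^esub> (c \<odot>\<^bsub>A\<^esub> a)),
      oper = (\<lambda>C. \<Union>a\<in>C. I +>\<^bsub>A\<^esub> oper A a)\<rparr>"

text \<open>The family \<open>b\<close> indexed by \<open>I\<close> is a basis: it generates and is linearly independent.\<close>

definition module_basis ::
    "('k::comm_ring_1, 'a, 'm) Module.module_scheme \<Rightarrow> ('i \<Rightarrow> 'a) \<Rightarrow> 'i set \<Rightarrow> bool" where
  "module_basis M b I \<longleftrightarrow>
     b \<in> I \<rightarrow> carrier M \<and>
     (\<forall>m\<in>carrier M. \<exists>c :: 'i \<Rightarrow>\<^sub>0 'k. Poly_Mapping.keys c \<subseteq> I \<and>
        m = (\<Oplus>\<^bsub>M\<^esub>i\<in>Poly_Mapping.keys c. Poly_Mapping.lookup c i \<odot>\<^bsub>M\<^esub> b i)) \<and>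
     (\<forall>c :: 'i \<Rightarrow>\<^sub>0 'k. Poly_Mapping.keys c \<subseteq> I \<longrightarrow>
        (\<Oplus>\<^bsub>M\<^esub>i\<in>Poly_Mapping.keys c. Poly_Mapping.lookup c i \<odot>\<^bsub>M\<^esub> b i) = \<zero>\<^bsub>M\<^esub> \<longrightarrow> c = 0)"

definition word_algebra :: "('k::comm_ring_1, 'x bword \<Rightarrow>\<^sub>0 'k) operated_algebra" where
  "word_algebra =
     \<lparr>carrier = UNIV, monoid.mult = word_mult, one = undefined, ring.zero = 0, add = (+),
      module.smult = scale, oper = lin_ext bracket\<rparr>"

section \<open>The Rota-Baxter relations\<close>

definition S_rbr :: "'k::comm_ring_1 \<Rightarrow> ('x bword \<Rightarrow>\<^sub>0 'k) set" where
  "S_rbr lam =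
     {basis_elem \<lfloor>x \<cdot> \<lfloor>y\<rfloor>\<^sub>B\<rfloor>\<^sub>B + basis_elem \<lfloor>\<lfloor>x\<rfloor>\<^sub>B \<cdot> y\<rfloor>\<^sub>B + scale lam (basis_elem \<lfloor>x \<cdot> y\<rfloor>\<^sub>B)
        - basis_elem (\<lfloor>x\<rfloor>\<^sub>B \<cdot> \<lfloor>y\<rfloor>\<^sub>B) | x y. True}"

definition Irr_rbr :: "'x bword set" where
  "Irr_rbr = UNIV - {subst_star q \<lfloor>x \<cdot> \<lfloor>y\<rfloor>\<^sub>B\<rfloor>\<^sub>B | q x y. q \<in> star_words}"

definition Id_rbr :: "'k::comm_ring_1 \<Rightarrow> ('x bword \<Rightarrow>\<^sub>0 'k) set" where
  "Id_rbr lam = operated_ideal_gen word_algebra (S_rbr lam)"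

definition rbr_quotient :: "'k::comm_ring_1 \<Rightarrow> ('k, ('x bword \<Rightarrow>\<^sub>0 'k) set) operated_algebra" where
  "rbr_quotient lam = quotient_operated_algebra word_algebra (Id_rbr lam)"

definition rbr_class :: "'k::comm_ring_1 \<Rightarrow> 'x bword \<Rightarrow> ('x bword \<Rightarrow>\<^sub>0 'k) set" where
  "rbr_class lam w = Id_rbr lam +>\<^bsub>word_algebra :: ('k, 'x bword \<Rightarrow>\<^sub>0 'k) operated_algebra\<^esub> basis_elem w"

end

(*
  A leading monomial of a Rota-Baxter relation has breadth 1, so there are no intersection
  compositions, and the only including composition that is not a mere substitution comes from
  bracketing x followed by the bracket of (u followed by the bracket of v). In all the comparisons
  with the ambiguity that are needed, the length of the path of a single letter decides.

  For the basis, the module of all words with concatenation as product carries a second operator P,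
  defined by the recursion that the relations dictate:
    P (x [y]) = P x [y] - P (P x y) - lam P (x y),   and P w = [w] for w of any other form.
  The Rota-Baxter identity for P holds on all words, by induction on the second argument. Hence
  evaluating words in this algebra is a linear map that kills the ideal; it fixes the irreducible
  words, takes values in their span, and changes every word only modulo the ideal.
*)
theory Submission
  imports Defs
begin

text \<open>Deducing (b) from (a) by leading monomials would take an order that is antisymmetric and
  compatible with all contexts; \<open>plr_le\<close> is neither, so linear independence comes from
  a model. A forbidden word is a single bracket, hence the irreducible words are closed under
  concatenation; concatenation can therefore serve as the product of the model, and only the
  operator has to be built. Its recursion is the relation solved for its leading word, where every
  bracket is read as the operator except the one around y, which stays formal as a last factor. The
  recursion looks only at the last factor of a word, and left multiplication does not touch that
  factor: this is why the Rota-Baxter identity can be proved for an arbitrary first argument by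
  induction on the second. It stops because removing the bracket around the last factor shortens the
  path of the last letter while the degree stays the same.\<close>

section \<open>Linear extension\<close>

lemma lookup_scale [simp]: "Poly_Mapping.lookup (scale c f) w = c * Poly_Mapping.lookup f w"
  by (simp add: scale_def Poly_Mapping.map.rep_eq when_def)

interpretation scale: Modules.module "scale :: 'k::comm_ring_1 \<Rightarrow> ('w \<Rightarrow>\<^sub>0 'k) \<Rightarrow> _"
  by unfold_locales (auto intro!: poly_mapping_eqI simp: lookup_add algebra_simps)

lemma scale_single: "scale c (Poly_Mapping.single w d) = Poly_Mapping.single w (c * d)"
  by (auto intro!: poly_mapping_eqI simp: lookup_single when_def)

lemma sum_scale_basis: "(\<Sum>u\<in>Poly_Mapping.keys f. scale (Poly_Mapping.lookup f u) (basis_elem u)) = f"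
  by (auto intro!: poly_mapping_eqI simp: lookup_sum lookup_single when_def in_keys_iff if_distrib cong: if_cong)

text \<open>Reduces identities that are linear in an argument to identities on words. Zero is
  covered as 0 times a basis element.\<close>

lemma basis_elem_induct [case_names basis scale add]:
  assumes "\<And>w. P (basis_elem w)" "\<And>c f. P f \<Longrightarrow> P (scale c f)"
    and "\<And>f g. P f \<Longrightarrow> P g \<Longrightarrow> P (f + g)"
  shows "P f"
proof -
  have zero: "P 0"
    using assms(2)[OF assms(1), of 0] by simp
  have "P (\<Sum>u\<in>A. scale (Poly_Mapping.lookup f u) (basis_elem u))" if "finite A" for A
    using that by (induction rule: finite_induct) (auto intro: assms zero)
  then show ?thesis
    using sum_scale_basis[of f] by (metis finite_keys)
qed

text \<open>\<open>lin_ext\<close> sends words to words only. The operator \<open>rb_op\<close> and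
  the normal form send a word to a combination of words, hence this more general linear
  extension.\<close>

definition lin_lift :: "('v \<Rightarrow> ('w \<Rightarrow>\<^sub>0 'k::comm_ring_1)) \<Rightarrow> ('v \<Rightarrow>\<^sub>0 'k) \<Rightarrow> ('w \<Rightarrow>\<^sub>0 'k)" where
  "lin_lift \<phi> f = (\<Sum>u\<in>Poly_Mapping.keys f. scale (Poly_Mapping.lookup f u) (\<phi> u))"

lemma lin_lift_superset:
  assumes "finite A" "Poly_Mapping.keys f \<subseteq> A"
  shows "lin_lift \<phi> f = (\<Sum>u\<in>A. scale (Poly_Mapping.lookup f u) (\<phi> u))"
  unfolding lin_lift_def using assms by (intro sum.mono_neutral_left) (auto simp: in_keys_iff)

lemma lin_lift_add: "lin_lift \<phi> (f + g) = lin_lift \<phi> f + lin_lift \<phi> g"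
proof -
  let ?A = "Poly_Mapping.keys f \<union> Poly_Mapping.keys g"
  have "lin_lift \<phi> (f + g) = (\<Sum>u\<in>?A. scale (Poly_Mapping.lookup (f + g) u) (\<phi> u))"
    by (rule lin_lift_superset) (auto dest: keys_add[THEN subsetD])
  also have "\<dots> = (\<Sum>u\<in>?A. scale (Poly_Mapping.lookup f u) (\<phi> u)) + (\<Sum>u\<in>?A. scale (Poly_Mapping.lookup g u) (\<phi> u))"
    by (simp add: lookup_add scale.scale_left_distrib sum.distrib)
  finally show ?thesis
    by (simp flip: lin_lift_superset)
qed

lemma lin_lift_scale: "lin_lift \<phi> (scale c f) = scale c (lin_lift \<phi> f)"
proof -
  have "lin_lift \<phi> (scale c f) = (\<Sum>u\<in>Poly_Mapping.keys f. scale (Poly_Mapping.lookup (scale c f) u) (\<phi> u))"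
    by (rule lin_lift_superset) (auto simp: in_keys_iff)
  then show ?thesis
    by (simp add: lin_lift_def scale.scale_sum_right)
qed

lemma lin_lift_basis [simp]: "lin_lift \<phi> (basis_elem w) = \<phi> w"
  by (simp add: lin_lift_def)

interpretation lin_lift: module_hom scale scale "lin_lift \<phi> :: ('v \<Rightarrow>\<^sub>0 'k::comm_ring_1) \<Rightarrow> ('w \<Rightarrow>\<^sub>0 'k)" for \<phi>
  by unfold_locales (simp_all add: lin_lift_add lin_lift_scale)

lemma keys_lin_lift:
  assumes "\<And>u. u \<in> Poly_Mapping.keys f \<Longrightarrow> Poly_Mapping.keys (\<phi> u) \<subseteq> A"
  shows "Poly_Mapping.keys (lin_lift \<phi> f) \<subseteq> A"
proof -
  have "Poly_Mapping.keys (lin_lift \<phi> f) \<subseteq>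
      (\<Union>u\<in>Poly_Mapping.keys f. Poly_Mapping.keys (scale (Poly_Mapping.lookup f u) (\<phi> u)))"
    unfolding lin_lift_def by (rule keys_sum)
  also have "\<dots> \<subseteq> A"
    using assms by (force simp: in_keys_iff)
  finally show ?thesis .
qed

lemma lin_ext_eq: "lin_ext \<phi> = lin_lift (\<lambda>u. basis_elem (\<phi> u))"
  by (simp add: fun_eq_iff lin_ext_def lin_lift_def scale_single)

lemma word_mult_eq: "word_mult f g = lin_lift (\<lambda>u. lin_ext ((\<cdot>) u) g) f"
  by (simp add: word_mult_def lin_ext_eq lin_lift_def scale_single scale.scale_sum_right)

interpretation lin_ext: module_hom scale scale "lin_ext \<phi> :: ('v \<Rightarrow>\<^sub>0 'k::comm_ring_1) \<Rightarrow> ('w \<Rightarrow>\<^sub>0 'k)" for \<phi>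
  unfolding lin_ext_eq by (rule lin_lift.module_hom_axioms)

lemma lin_ext_basis [simp]: "lin_ext \<phi> (basis_elem w) = basis_elem (\<phi> w)"
  by (simp add: lin_ext_eq)

lemma word_mult_basis [simp]: "word_mult (basis_elem u) (basis_elem v) = basis_elem (u \<cdot> v)"
  by (simp add: word_mult_eq)

interpretation word_mult_left: module_hom scale scale
    "\<lambda>f :: 'x bword \<Rightarrow>\<^sub>0 'k::comm_ring_1. word_mult f g" for g
  unfolding word_mult_eq by (rule lin_lift.module_hom_axioms)

interpretation word_mult_right: module_hom scale scale
    "\<lambda>g :: 'x bword \<Rightarrow>\<^sub>0 'k::comm_ring_1. word_mult f g" for f
proof unfold_locales
  show "word_mult f (g + h) = word_mult f g + word_mult f h" for g h
    by (simp add: word_mult_eq lin_ext.add lin_lift_def scale.scale_right_distrib sum.distrib)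
  show "word_mult f (scale c g) = scale c (word_mult f g)" for c g
    by (simp add: word_mult_eq lin_ext.scale lin_lift_def scale.scale_sum_right mult.commute)
qed

lemmas word_mult_linear =
  word_mult_left.add word_mult_left.diff word_mult_left.neg word_mult_left.scale word_mult_left.zero
  word_mult_right.add word_mult_right.diff word_mult_right.neg word_mult_right.scale word_mult_right.zero

lemmas lin_ext_linear = lin_ext.add lin_ext.diff lin_ext.neg lin_ext.scale lin_ext.zero
lemmas lin_lift_linear = lin_lift.add lin_lift.diff lin_lift.neg lin_lift.scale lin_lift.zero
lemmas scale_linear = scale.scale_right_distrib scale.scale_right_diff_distrib scale.scale_minus_right

interpretation subst_star_lin: module_hom scale scale
    "subst_star_lin q :: ('x bword \<Rightarrow>\<^sub>0 'k::comm_ring_1) \<Rightarrow> ('x bword \<Rightarrow>\<^sub>0 'k)" for q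
  unfolding subst_star_lin_def by (rule lin_ext.module_hom_axioms)

lemma subst_star_lin_basis [simp]: "subst_star_lin q (basis_elem w) = basis_elem (subst_star q w)"
  by (simp add: subst_star_lin_def)

lemmas subst_star_lin_linear =
  subst_star_lin.add subst_star_lin.diff subst_star_lin.neg subst_star_lin.scale subst_star_lin.zero

section \<open>Words and contexts\<close>

lemma bword_list_induct [case_names Prime Mult]:
  assumes "\<And>p. P (Prime p)" "\<And>p w. P w \<Longrightarrow> P (Mult p w)"
  shows "P w"
  by (rule bword.induct[of "\<lambda>_. True"]) (auto intro: assms)

lemma conc_assoc [simp]: "(u \<cdot> v) \<cdot> w = u \<cdot> v \<cdot> w"
  by (induction u rule: bword_list_induct) simp_all

lemma primes_of_conc [simp]: "primes_of (u \<cdot> v) = primes_of u @ primes_of v"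
  by (induction u rule: bword_list_induct) simp_all

lemma primes_of_ne_Nil [simp]: "primes_of w \<noteq> []" "[] \<noteq> primes_of w"
  by (cases w; simp)+

text \<open>Transfers the cancellation laws of lists to words; the injectivity rules for products
  with a known first or last prime come from it.\<close>

lemma primes_of_inject [simp]: "primes_of u = primes_of v \<longleftrightarrow> u = v"
proof
  show "primes_of u = primes_of v \<Longrightarrow> u = v"
  proof (induction u arbitrary: v rule: bword_list_induct)
    case (Prime p)
    then show ?case by (cases v) simp_all
  next
    case (Mult p w)
    then show ?case by (cases v) auto
  qed
qed simp

lemma breadth_simps [simp]:
  "breadth (Prime p) = 1" "breadth (Mult p w) = Suc (breadth w)" "breadth (u \<cdot> v) = breadth u + breadth v"
  by (simp_all add: breadth_def)

lemma breadth_pos [simp]: "breadth w > 0"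
  by (simp add: breadth_def)

lemma conc_Prime_inject [simp]: "u \<cdot> Prime p = v \<cdot> Prime q \<longleftrightarrow> u = v \<and> p = q"
  by (simp flip: primes_of_inject)

lemma conc_ne_Prime [simp]: "u \<cdot> v \<noteq> Prime p" "Prime p \<noteq> u \<cdot> v"
  by (cases u; simp)+

lemma letters_conc [simp]: "letters (u \<cdot> v) = letters u @ letters v"
  by (induction u rule: bword_list_induct) simp_all

lemma subst_star_conc [simp]: "subst_star (p \<cdot> q) u = subst_star p u \<cdot> subst_star q u"
  by (induction p rule: bword_list_induct) simp_all

lemma bdeg_simps [simp]:
  "bdeg (Prime (Letter x)) = 1" "bdeg \<lfloor>w\<rfloor>\<^sub>B = bdeg w" "bdeg (u \<cdot> v) = bdeg u + bdeg v"
  by (simp_all add: bdeg_def)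

lemma bdeg_pos [simp]: "bdeg w > 0"
proof -
  have "letters w \<noteq> []"
    by (rule bword.induct[of "\<lambda>p. prime_letters p \<noteq> []"]) auto
  then show ?thesis
    by (simp add: bdeg_def)
qed

lemma word_mult_assoc: "word_mult (word_mult f g) h = word_mult f (word_mult g h)"
proof (induction f rule: basis_elem_induct)
  case (basis u)
  show ?case
  proof (induction g rule: basis_elem_induct)
    case (basis v)
    show ?case
      by (induction h rule: basis_elem_induct) (simp_all add: word_mult_linear)
  qed (simp_all add: word_mult_linear)
qed (simp_all add: word_mult_linear)

lemma conc_Prime_left_inject [simp]: "Prime p \<cdot> u = Prime q \<cdot> v \<longleftrightarrow> p = q \<and> u = v"
  by (simp flip: primes_of_inject)

section \<open>Contexts: words with exactly one star\<close>

abbreviation embed :: "'x bword \<Rightarrow> 'x option bword" where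
  "embed \<equiv> map_bword Some"

abbreviation star :: "'x option bword" where
  "star \<equiv> Prime (Letter None)"

text \<open>The parts of a context beside its star are words over the extended alphabet; this
  identifies them with words over the original one, on which substitution acts trivially.\<close>

lemma starless_embed:
  fixes q :: "'x option bword" and p :: "'x option bprime"
  shows "count_list (letters q) None = 0 \<Longrightarrow> \<exists>z. q = embed z"
    and "count_list (prime_letters p) None = 0 \<Longrightarrow> \<exists>z. p = map_bprime Some z"
proof (induction q and p rule: bword.induct bprime.induct)
  case (Prime p)
  then show ?case by (auto intro: exI[of _ "Prime _"])
next
  case (Mult p w)
  then show ?case by (auto intro: exI[of _ "Mult _ _"])
next
  case (Letter x)
  then show ?case by (cases x) (auto intro: exI[of _ "Letter _"])
next
  case (Bracket w)
  then show ?case by (auto intro: exI[of _ "Bracket _"])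
qed

lemma count_list_embed [simp]: "count_list (letters (embed z)) None = 0"
  by (rule bword.induct[of "\<lambda>p. count_list (prime_letters (map_bprime Some p)) None = 0"
      "\<lambda>w. count_list (letters (embed w)) None = 0"]) auto

lemma subst_star_embed [simp]: "subst_star (embed z) u = z"
  by (rule bword.induct[of "\<lambda>p. subst_star_prime (map_bprime Some p) u = Prime p"]) auto

lemma embed_conc [simp]: "embed (u \<cdot> v) = embed u \<cdot> embed v"
  by (induction u rule: bword_list_induct) simp_all

text \<open>From here on \<open>Prime p \<cdot> w\<close> is the simp normal form of \<open>Mult p w\<close>.\<close>

declare conc.simps(1) [simp del] conc.simps(1) [symmetric, simp]

lemma star_words_simps [simp]:
  "star \<in> star_words" "\<lfloor>q\<rfloor>\<^sub>B \<in> star_words \<longleftrightarrow> q \<in> star_words"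
  "embed z \<cdot> q \<in> star_words \<longleftrightarrow> q \<in> star_words" "q \<cdot> embed z \<in> star_words \<longleftrightarrow> q \<in> star_words"
  "\<lfloor>embed z\<rfloor>\<^sub>B \<cdot> q \<in> star_words \<longleftrightarrow> q \<in> star_words" "q \<cdot> \<lfloor>embed z\<rfloor>\<^sub>B \<in> star_words \<longleftrightarrow> q \<in> star_words"
  by (simp_all add: star_words_def)

lemma star_words_Mult_cases:
  assumes "Mult p q \<in> star_words"
  obtains z where "q = embed z" "Prime p \<in> star_words"
  | z where "p = map_bprime Some z" "q \<in> star_words"
proof -
  have "count_list (prime_letters p) None + count_list (letters q) None = 1"
    using assms by (simp add: star_words_def)
  then consider "count_list (prime_letters p) None = 1" "count_list (letters q) None = 0"
    | "count_list (prime_letters p) None = 0" "count_list (letters q) None = 1"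
    by linarith
  then show thesis
    by cases (auto dest!: starless_embed intro: that simp: star_words_def)
qed

text \<open>Contexts are generated from the star by bracketing and by multiplication with starless
  words on either side, so compatibility of a relation with all contexts reduces to these
  operations.\<close>

lemma star_words_induct [consumes 1, case_names star bracket right left]:
  assumes "q \<in> star_words"
    and star: "P star"
    and bracket: "\<And>q. q \<in> star_words \<Longrightarrow> P q \<Longrightarrow> P \<lfloor>q\<rfloor>\<^sub>B"
    and right: "\<And>q z. q \<in> star_words \<Longrightarrow> P q \<Longrightarrow> P (q \<cdot> embed z)"
    and left: "\<And>q z. q \<in> star_words \<Longrightarrow> P q \<Longrightarrow> P (embed z \<cdot> q)"
  shows "P q"
proof -
  have "q \<in> star_words \<Longrightarrow> P q" and "Prime p \<in> star_words \<Longrightarrow> P (Prime p)" for p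
  proof (induction q and p rule: bword.induct bprime.induct)
    case (Mult p q)
    from Mult.prems show ?case
    proof (cases rule: star_words_Mult_cases)
      case (1 z)
      then show ?thesis using right[of "Prime p" z] Mult.IH by simp
    next
      case (2 z)
      then show ?thesis using left[of q "Prime z"] Mult.IH by simp
    qed
  next
    case (Letter x)
    then show ?case by (cases x) (auto simp: star_words_def intro: star)
  next
    case (Bracket w)
    then show ?case using bracket by simp
  qed simp_all
  with assms(1) show ?thesis by blast
qed

lemma subst_star_lin_star: "subst_star_lin star f = f"
  by (induction f rule: basis_elem_induct) (simp_all add: subst_star_lin_linear)

lemma breadth_ne_0 [simp]: "breadth w \<noteq> 0"
  using breadth_pos[of w] by simp

section \<open>Comparison through paths\<close>

text \<open>The paths with the outermost \<open>PMu\<close> left off. Unlike \<open>paths\<close>,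
  this turns concatenation of words into concatenation of lists, whatever the breadth of the
  factors.\<close>

definition inner_paths :: "'x bword \<Rightarrow> 'x path_symbol list list" where
  "inner_paths w = concat (map prime_paths (primes_of w))"

declare paths.simps [simp del]

lemma paths_eq: "paths w = (if breadth w = 1 then inner_paths w else map ((#) PMu) (inner_paths w))"
  by (simp add: paths.simps inner_paths_def)

lemma inner_paths_simps [simp]:
  "inner_paths (Prime (Letter x)) = [[PLetter x]]"
  "inner_paths \<lfloor>w\<rfloor>\<^sub>B = map ((#) PP) (paths w)"
  "inner_paths (u \<cdot> v) = inner_paths u @ inner_paths v"
  by (simp_all add: inner_paths_def)

lemma inner_paths_Mult [simp]: "inner_paths (Mult p w) = prime_paths p @ inner_paths w"
  by (simp add: inner_paths_def)

lemma paths_conc: "paths (u \<cdot> v) = map ((#) PMu) (inner_paths u @ inner_paths v)"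
  using breadth_pos[of u] breadth_pos[of v] by (simp add: paths_eq del: breadth_pos)

lemma length_inner_paths [simp]: "length (inner_paths w) = bdeg w"
proof -
  have "length (inner_paths w) = length (letters w)"
    by (rule bword.induct[of "\<lambda>p. length (prime_paths p) = length (prime_letters p)"])
      (simp_all add: inner_paths_def paths_eq)
  then show ?thesis
    by (simp add: bdeg_def)
qed

lemma length_paths [simp]: "length (paths w) = bdeg w"
  by (simp add: paths_eq)

lemma paths_ne_Nil [simp]: "paths w \<noteq> []" "inner_paths w \<noteq> []"
  using bdeg_pos[of w] by (metis length_paths length_inner_paths list.size(3) less_irrefl)+

text \<open>\<open>path_r\<close> puts the path of the rightmost letter first, so the length of this
  path is what a comparison meets first. The same number later serves as the second termination
  measure of \<open>rb_op\<close>.\<close>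

definition last_len :: "'x bword \<Rightarrow> nat" where
  "last_len w = length (last (inner_paths w))"

lemma length_last_paths: "length (last (paths w)) = last_len w + (if breadth w = 1 then 0 else 1)"
  by (simp add: paths_eq last_len_def last_map)

lemma last_len_simps [simp]:
  "last_len (Prime (Letter x)) = 1" "last_len (u \<cdot> v) = last_len v" "last_len (Mult p v) = last_len v"
  "last_len \<lfloor>w\<rfloor>\<^sub>B = last_len w + (if breadth w = 1 then 1 else 2)"
  using length_last_paths[of w] by (simp_all add: last_len_def last_map)

text \<open>Read from the right, as in \<open>path_r\<close>, the first difference is a strictly
  shorter path. Equal lengths of \<open>as\<close> and \<open>bs\<close> express equal
  degree.\<close>

definition shorter :: "'a list list \<Rightarrow> 'a list list \<Rightarrow> bool" where
  "shorter us vs \<longleftrightarrow> (\<exists>as bs a b cs. us = as @ a # cs \<and> vs = bs @ b # cs \<and>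
     length as = length bs \<and> length a < length b)"

lemma shorter_map_Cons: "shorter us vs \<Longrightarrow> shorter (map ((#) s) us) (map ((#) s) vs)"
  by (fastforce simp: shorter_def)

lemma shorter_append_right: "shorter us vs \<Longrightarrow> shorter (us @ cs) (vs @ cs)"
  by (fastforce simp: shorter_def)

lemma shorter_append_left: "shorter us vs \<Longrightarrow> shorter (cs @ us) (cs @ vs)"
  unfolding shorter_def by (metis append_assoc length_append)

lemma shorter_last:
  assumes "us \<noteq> []" "length us = length vs" "length (last us) < length (last vs)"
  shows "shorter us vs"
  unfolding shorter_def
  using assms append_butlast_last_id[of us] append_butlast_last_id[of vs] length_butlast[of us] length_butlast[of vs]
  by (metis length_0_conv)

text \<open>
  The order is not compatible with all contexts: \<open>\<lfloor>xx\<rfloor>\<close> is smaller than \<open>\<lfloor>x\<rfloor>\<lfloor>x\<rfloor>\<close>, but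
  \<open>\<lfloor>xx\<rfloor>z\<close> is larger than \<open>\<lfloor>x\<rfloor>\<lfloor>x\<rfloor>z\<close>, since a factor of breadth 1 gains a \<open>\<mu>\<close>. The following
  stronger relation, which compares the paths both with and without the outermost \<open>\<mu>\<close>, is
  compatible with them.
\<close>

definition dominated :: "'x bword \<Rightarrow> 'x bword \<Rightarrow> bool" where
  "dominated u v \<longleftrightarrow> shorter (paths u) (paths v) \<and> shorter (inner_paths u) (inner_paths v)"

text \<open>Bracketing a word uses only its \<open>paths\<close>, multiplying it by another word
  uses only its \<open>inner_paths\<close>, and either operation yields both lists of the result.
  Hence the pair of comparisons is preserved although neither comparison is so alone.\<close>

lemma dominated_subst_star:
  assumes "q \<in> star_words" "dominated u v"
  shows "dominated (subst_star q u) (subst_star q v)"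
  using assms(1)
proof (induction q rule: star_words_induct)
  case star
  then show ?case using assms(2) by simp
next
  case (bracket q)
  then show ?case by (auto simp: dominated_def paths_eq[of "\<lfloor>_\<rfloor>\<^sub>B"] intro: shorter_map_Cons)
next
  case (right q z)
  then show ?case
    by (auto simp: dominated_def paths_conc simp flip: map_append
        intro: shorter_append_right intro!: shorter_map_Cons)
next
  case (left q z)
  then show ?case
    by (auto simp: dominated_def paths_conc simp flip: map_append
        intro: shorter_append_left intro!: shorter_map_Cons)
qed

lemma dominatedI:
  assumes "bdeg u = bdeg v" "length (last (paths u)) < length (last (paths v))" "last_len u < last_len v"
  shows "dominated u v"
  using assms by (auto simp: dominated_def last_len_def intro!: shorter_last)

lemma strict_plr_le_if_dominated:
  assumes "dominated u v"
  shows "strict plr_le u v"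
proof -
  let ?R = "lenlex path_symbol_less :: 'a path_symbol list rel"
  obtain as bs a b cs where u: "paths u = as @ a # cs" and v: "paths v = bs @ b # cs"
    and len: "length as = length bs" and ab: "length a < length b"
    using assms by (auto simp: dominated_def shorter_def)
  have deg: "bdeg u = bdeg v"
    using u v len by (metis length_paths length_append length_Cons)
  have "(a, b) \<in> ?R"
    using ab by (simp add: lenlex_conv)
  then have "(path_r u, path_r v) \<in> lex ?R"
    using len by (auto simp: path_r_def u v lex_conv)
  moreover have "(path_r v, path_r u) \<notin> lex ?R"
  proof
    have irrefl: "\<forall>xs. (xs, xs) \<notin> ?R"
      by (auto intro!: lenlex_irreflexive simp: path_symbol_less_def)
    assume "(path_r v, path_r u) \<in> lex ?R"
    \<comment> \<open>Reversal turns the common suffix \<open>cs\<close> into a common prefix, which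
      can be cancelled because the order of paths is irreflexive.\<close>
    then have "(b # rev bs, a # rev as) \<in> lex ?R"
      using irrefl by (auto simp: path_r_def u v dest!: lex_append_leftD[rotated])
    then show False
      using ab by (auto simp: lenlex_conv)
  qed
  moreover have "path_r u \<noteq> path_r v"
    using u v len ab by (auto simp: path_r_def)
  ultimately show ?thesis
    by (auto simp: strict_def plr_le_def deg)
qed

section \<open>Compositions\<close>

lemma lead_eqI:
  assumes "m \<in> Poly_Mapping.keys f" "\<And>m'. m' \<in> Poly_Mapping.keys f \<Longrightarrow> m' \<noteq> m \<Longrightarrow> strict leq m' m"
  shows "lead leq f = m"
  unfolding lead_def
proof (rule the_equality)
  show "m \<in> Poly_Mapping.keys f \<and> (\<forall>m'\<in>Poly_Mapping.keys f. m' \<noteq> m \<longrightarrow> strict leq m' m)"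
    using assms by blast
next
  fix n assume "n \<in> Poly_Mapping.keys f \<and> (\<forall>m'\<in>Poly_Mapping.keys f. m' \<noteq> n \<longrightarrow> strict leq m' n)"
  with assms show "n = m"
    unfolding strict_def by metis
qed

definition rb_rel :: "'k::comm_ring_1 \<Rightarrow> 'x bword \<Rightarrow> 'x bword \<Rightarrow> ('x bword \<Rightarrow>\<^sub>0 'k)" where
  "rb_rel lam x y =
     basis_elem \<lfloor>x \<cdot> \<lfloor>y\<rfloor>\<^sub>B\<rfloor>\<^sub>B + basis_elem \<lfloor>\<lfloor>x\<rfloor>\<^sub>B \<cdot> y\<rfloor>\<^sub>B + scale lam (basis_elem \<lfloor>x \<cdot> y\<rfloor>\<^sub>B)
       - basis_elem (\<lfloor>x\<rfloor>\<^sub>B \<cdot> \<lfloor>y\<rfloor>\<^sub>B)"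

lemma S_rbr_eq: "S_rbr lam = {rb_rel lam x y | x y. True}"
  by (simp add: S_rbr_def rb_rel_def)

text \<open>The last letter lies in y. In the leading word its path starts with PP, PMu, PP and goes
  on with its path in y; the first two of the other words lose the bracket around y, the third loses
  the outer bracket.\<close>

lemma dominated_tail:
  fixes x y :: "'x bword"
  shows "dominated \<lfloor>\<lfloor>x\<rfloor>\<^sub>B \<cdot> y\<rfloor>\<^sub>B \<lfloor>x \<cdot> \<lfloor>y\<rfloor>\<^sub>B\<rfloor>\<^sub>B"
    "dominated \<lfloor>x \<cdot> y\<rfloor>\<^sub>B \<lfloor>x \<cdot> \<lfloor>y\<rfloor>\<^sub>B\<rfloor>\<^sub>B"
    "dominated (\<lfloor>x\<rfloor>\<^sub>B \<cdot> \<lfloor>y\<rfloor>\<^sub>B) \<lfloor>x \<cdot> \<lfloor>y\<rfloor>\<^sub>B\<rfloor>\<^sub>B"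
  by (auto intro!: dominatedI simp: length_last_paths)

lemma dominated_irrefl: "\<not> dominated (u :: 'x::wellorder bword) u"
  using strict_plr_le_if_dominated[of u u] by (auto simp: strict_def)

text \<open>In every context the three other monomials are dominated by the leading one. As
  domination is irreflexive, none of them can coincide with it, so its coefficient 1 does not
  change.\<close>

lemma
  assumes "q \<in> star_words"
  shows lead_subst_rb_rel:
      "lead plr_le (subst_star_lin q (rb_rel lam x y)) = subst_star q \<lfloor>x \<cdot> \<lfloor>y\<rfloor>\<^sub>B\<rfloor>\<^sub>B" (is ?lead)
    and lookup_subst_rb_rel:
      "Poly_Mapping.lookup (subst_star_lin q (rb_rel lam x y)) (subst_star q \<lfloor>x \<cdot> \<lfloor>y\<rfloor>\<^sub>B\<rfloor>\<^sub>B) = 1" (is ?coeff)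
proof -
  let ?m = "subst_star q \<lfloor>x \<cdot> \<lfloor>y\<rfloor>\<^sub>B\<rfloor>\<^sub>B"
  let ?r = "{subst_star q \<lfloor>\<lfloor>x\<rfloor>\<^sub>B \<cdot> y\<rfloor>\<^sub>B, subst_star q \<lfloor>x \<cdot> y\<rfloor>\<^sub>B, subst_star q (\<lfloor>x\<rfloor>\<^sub>B \<cdot> \<lfloor>y\<rfloor>\<^sub>B)}"
  have dom: "dominated m' ?m" if "m' \<in> ?r" for m'
    using that by (auto intro: dominated_subst_star[OF assms] dominated_tail)
  then have "m' \<noteq> ?m \<and> ?m \<noteq> m'" if "m' \<in> ?r" for m'
    using that dominated_irrefl by metis
  then show coeff: ?coeff
    by (simp add: rb_rel_def subst_star_lin_linear lookup_add lookup_minus lookup_single when_def)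
  show ?lead
  proof (rule lead_eqI)
    show "?m \<in> Poly_Mapping.keys (subst_star_lin q (rb_rel lam x y))"
      using coeff by (simp add: in_keys_iff)
  next
    fix m' assume "m' \<in> Poly_Mapping.keys (subst_star_lin q (rb_rel lam x y))" "m' \<noteq> ?m"
    then have "m' \<in> ?r"
      by (auto simp: rb_rel_def subst_star_lin_linear in_keys_iff lookup_add lookup_minus lookup_single
          when_def split: if_splits)
    then show "strict plr_le m' ?m"
      by (intro strict_plr_le_if_dominated dom)
  qed
qed

lemmas lead_rb_rel = lead_subst_rb_rel[OF star_words_simps(1), unfolded subst_star_lin_star, simplified]
lemmas lookup_rb_rel = lookup_subst_rb_rel[OF star_words_simps(1), unfolded subst_star_lin_star, simplified]

lemma trivial_mod_add:
  "trivial_mod leq S w f \<Longrightarrow> trivial_mod leq S w g \<Longrightarrow> trivial_mod leq S w (f + g)"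
  unfolding trivial_mod_def
  by (elim exE conjE, rule_tac x = "ts @ tsa" in exI) auto

lemma trivial_mod_scale:
  assumes "trivial_mod leq S w f"
  shows "trivial_mod leq S w (scale c f)"
proof -
  obtain ts where ts: "f = (\<Sum>(d, q, s)\<leftarrow>ts. scale d (subst_star_lin q s))"
    "\<forall>(d, q, s)\<in>set ts. q \<in> star_words \<and> s \<in> S \<and> strict leq (lead leq (subst_star_lin q s)) w"
    using assms by (auto simp: trivial_mod_def)
  have "scale c (\<Sum>(d, q, s)\<leftarrow>ts. scale d (subst_star_lin q s)) =
      (\<Sum>(d, q, s)\<leftarrow>map (\<lambda>(d, q, s). (c * d, q, s)) ts. scale d (subst_star_lin q s))"
    by (induction ts) (auto simp: scale.scale_right_distrib)
  moreover have "\<forall>(d, q, s)\<in>set (map (\<lambda>(d, q, s). (c * d, q, s)) ts).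
      q \<in> star_words \<and> s \<in> S \<and> strict leq (lead leq (subst_star_lin q s)) w"
    using ts(2) by auto
  ultimately show ?thesis
    unfolding trivial_mod_def ts(1) by blast
qed

lemma trivial_mod_diff:
  "trivial_mod leq S w f \<Longrightarrow> trivial_mod leq S w g \<Longrightarrow> trivial_mod leq S w (f - g)"
  using trivial_mod_add[of leq S w f "scale (- 1) g"] trivial_mod_scale[of leq S w g "- 1"] by simp

section \<open>Triviality of the including compositions\<close>

lemma trivial_mod_subst_rb_rel:
  assumes "q \<in> star_words" "dominated (subst_star q \<lfloor>x \<cdot> \<lfloor>y\<rfloor>\<^sub>B\<rfloor>\<^sub>B) w"
  shows "trivial_mod plr_le (S_rbr lam) w (subst_star_lin q (rb_rel lam x y))"
  unfolding trivial_mod_def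
  using assms by (intro exI[of _ "[(1, q, rb_rel lam x y)]"])
    (auto simp: S_rbr_eq lead_subst_rb_rel strict_plr_le_if_dominated)

lemma trivial_mod_rb_rel:
  assumes "dominated \<lfloor>x \<cdot> \<lfloor>y\<rfloor>\<^sub>B\<rfloor>\<^sub>B w"
  shows "trivial_mod plr_le (S_rbr lam) w (rb_rel lam x y)"
  using trivial_mod_subst_rb_rel[of star x y w lam] assms by (simp add: subst_star_lin_star)

lemmas trivial_mod_intros = trivial_mod_add trivial_mod_diff trivial_mod_scale trivial_mod_rb_rel trivial_mod_subst_rb_rel

text \<open>The inner leading word lies in \<open>x\<close>. Extend the outer relation linearly in
  its first argument and evaluate it at \<open>q\<close> filled with the whole inner relation.
  Expanding the result along the four monomials of the outer relation, or along those of the inner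
  one, gives the same element; solving for the two terms of the composition leaves only terms with
  smaller leading words.\<close>

lemma trivial_mod_left:
  assumes q: "q \<in> star_words" and x: "x = subst_star q \<lfloor>u \<cdot> \<lfloor>v\<rfloor>\<^sub>B\<rfloor>\<^sub>B"
  shows "trivial_mod plr_le (S_rbr lam) \<lfloor>x \<cdot> \<lfloor>y\<rfloor>\<^sub>B\<rfloor>\<^sub>B
    (rb_rel lam x y - subst_star_lin \<lfloor>q \<cdot> embed \<lfloor>y\<rfloor>\<^sub>B\<rfloor>\<^sub>B (rb_rel lam u v))" (is "trivial_mod _ _ ?w ?h")
proof -
  have "?h = subst_star_lin \<lfloor>\<lfloor>q\<rfloor>\<^sub>B \<cdot> embed y\<rfloor>\<^sub>B (rb_rel lam u v)
      + scale lam (subst_star_lin \<lfloor>q \<cdot> embed y\<rfloor>\<^sub>B (rb_rel lam u v))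
      - subst_star_lin (\<lfloor>q\<rfloor>\<^sub>B \<cdot> embed \<lfloor>y\<rfloor>\<^sub>B) (rb_rel lam u v)
      - (rb_rel lam (subst_star q \<lfloor>\<lfloor>u\<rfloor>\<^sub>B \<cdot> v\<rfloor>\<^sub>B) y
        + scale lam (rb_rel lam (subst_star q \<lfloor>u \<cdot> v\<rfloor>\<^sub>B) y)
        - rb_rel lam (subst_star q (\<lfloor>u\<rfloor>\<^sub>B \<cdot> \<lfloor>v\<rfloor>\<^sub>B)) y)"
    by (simp add: x rb_rel_def subst_star_lin_linear scale_linear algebra_simps)
  moreover have "dominated \<lfloor>subst_star q r \<cdot> \<lfloor>y\<rfloor>\<^sub>B\<rfloor>\<^sub>B ?w" if "dominated r \<lfloor>u \<cdot> \<lfloor>v\<rfloor>\<^sub>B\<rfloor>\<^sub>B" for r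
    using dominated_subst_star[of "\<lfloor>q \<cdot> embed \<lfloor>y\<rfloor>\<^sub>B\<rfloor>\<^sub>B", OF _ that] q by (simp add: x)
  ultimately show ?thesis
    using q dominated_tail[of x y] by (auto intro!: trivial_mod_intros dominated_tail simp: x)
qed

text \<open>The same double expansion, with the outer relation extended linearly in its second
  argument.\<close>

lemma trivial_mod_right:
  assumes q: "q \<in> star_words" and y: "y = subst_star q \<lfloor>u \<cdot> \<lfloor>v\<rfloor>\<^sub>B\<rfloor>\<^sub>B"
  shows "trivial_mod plr_le (S_rbr lam) \<lfloor>x \<cdot> \<lfloor>y\<rfloor>\<^sub>B\<rfloor>\<^sub>B
    (rb_rel lam x y - subst_star_lin \<lfloor>embed x \<cdot> \<lfloor>q\<rfloor>\<^sub>B\<rfloor>\<^sub>B (rb_rel lam u v))" (is "trivial_mod _ _ ?w ?h")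
proof -
  have "?h = subst_star_lin \<lfloor>embed \<lfloor>x\<rfloor>\<^sub>B \<cdot> q\<rfloor>\<^sub>B (rb_rel lam u v)
      + scale lam (subst_star_lin \<lfloor>embed x \<cdot> q\<rfloor>\<^sub>B (rb_rel lam u v))
      - subst_star_lin (embed \<lfloor>x\<rfloor>\<^sub>B \<cdot> \<lfloor>q\<rfloor>\<^sub>B) (rb_rel lam u v)
      - (rb_rel lam x (subst_star q \<lfloor>\<lfloor>u\<rfloor>\<^sub>B \<cdot> v\<rfloor>\<^sub>B)
        + scale lam (rb_rel lam x (subst_star q \<lfloor>u \<cdot> v\<rfloor>\<^sub>B))
        - rb_rel lam x (subst_star q (\<lfloor>u\<rfloor>\<^sub>B \<cdot> \<lfloor>v\<rfloor>\<^sub>B)))"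
    by (simp add: y rb_rel_def subst_star_lin_linear scale_linear algebra_simps)
  moreover have "dominated \<lfloor>x \<cdot> \<lfloor>subst_star q r\<rfloor>\<^sub>B\<rfloor>\<^sub>B ?w" if "dominated r \<lfloor>u \<cdot> \<lfloor>v\<rfloor>\<^sub>B\<rfloor>\<^sub>B" for r
    using dominated_subst_star[of "\<lfloor>embed x \<cdot> \<lfloor>q\<rfloor>\<^sub>B\<rfloor>\<^sub>B", OF _ that] q by (simp add: y)
  ultimately show ?thesis
    using q dominated_tail[of x y] by (auto intro!: trivial_mod_intros dominated_tail simp: y)
qed

lemma trivial_mod_overlap:
  "trivial_mod plr_le (S_rbr lam) \<lfloor>x \<cdot> \<lfloor>u \<cdot> \<lfloor>v\<rfloor>\<^sub>B\<rfloor>\<^sub>B\<rfloor>\<^sub>B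
    (rb_rel lam x (u \<cdot> \<lfloor>v\<rfloor>\<^sub>B) - subst_star_lin \<lfloor>embed x \<cdot> star\<rfloor>\<^sub>B (rb_rel lam u v))" (is "trivial_mod _ _ ?w ?h")
proof -
  \<comment> \<open>The first three terms reduce the tail of the outer relation, the next three the
    tail of the inner one. The last two reduce what
    \<open>rb_rel lam (x \<cdot> \<lfloor>u\<rfloor>\<^sub>B) v\<close> leaves behind, namely two
    words that contain x [u] in a bracket. In every leading word used, the path of the last letter
    of v is shorter than in the ambiguity.\<close>
  have "?h = rb_rel lam (\<lfloor>x\<rfloor>\<^sub>B \<cdot> u) v + scale lam (rb_rel lam (x \<cdot> u) v)
      - subst_star_lin (embed \<lfloor>x\<rfloor>\<^sub>B \<cdot> star) (rb_rel lam u v)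
      - rb_rel lam x (\<lfloor>u\<rfloor>\<^sub>B \<cdot> v) - scale lam (rb_rel lam x (u \<cdot> v)) + rb_rel lam (x \<cdot> \<lfloor>u\<rfloor>\<^sub>B) v
      - subst_star_lin \<lfloor>star \<cdot> embed v\<rfloor>\<^sub>B (rb_rel lam x u)
      + subst_star_lin (star \<cdot> embed \<lfloor>v\<rfloor>\<^sub>B) (rb_rel lam x u)"
    by (simp add: rb_rel_def subst_star_lin_linear scale_linear algebra_simps)
  then show ?thesis
    by (auto intro!: trivial_mod_intros dominatedI simp: length_last_paths)
qed

text \<open>The substituted word is a single prime, so the cut between \<open>x\<close> and
  \<open>t\<close> cannot run through it: the star belongs to one of the two factors.\<close>

lemma subst_star_conc_cases:
  assumes "q \<in> star_words" "subst_star q (Prime p) = x \<cdot> t"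
  obtains (left) q' where "q' \<in> star_words" "q = q' \<cdot> embed t" "x = subst_star q' (Prime p)"
  | (right) q' where "q' \<in> star_words" "q = embed x \<cdot> q'" "t = subst_star q' (Prime p)"
  using assms
proof (induction q arbitrary: x thesis rule: bword_list_induct)
  case (Prime a)
  have "breadth (subst_star_prime a (Prime p)) = 1"
    by (cases a) (auto split: option.split)
  moreover have "breadth (x \<cdot> t) \<noteq> 1"
    using breadth_pos[of x] breadth_pos[of t] by (simp del: breadth_pos)
  ultimately show ?case
    using Prime.prems by simp
next
  case (Mult a q)
  have "\<exists>b. subst_star_prime a (Prime p) = Prime b"
    by (cases a) (auto split: option.split)
  then obtain b where b: "subst_star_prime a (Prime p) = Prime b"
    by blast
  from Mult.prems(3) show ?case
  proof (cases rule: star_words_Mult_cases)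
    case (1 z)
    show ?thesis
    proof (cases x)
      case (Prime c)
      then have "c = b" "z = t"
        using Mult.prems(4) b 1 by simp_all
      then show ?thesis
        using Mult.prems(1)[of "Prime a"] 1 b Prime by simp
    next
      case (Mult c x')
      then have "c = b" "z = x' \<cdot> t"
        using Mult.prems(4) b 1 by simp_all
      then show ?thesis
        using Mult.prems(1)[of "Prime a \<cdot> embed x'"] 1 b Mult by simp
    qed
  next
    case (2 z)
    then have z: "subst_star_prime a (Prime p) = Prime z"
      using subst_star_embed[of "Prime z"] by simp
    show ?thesis
    proof (cases x)
      case (Prime c)
      then show ?thesis
        using 2 z Mult.prems(2)[of q] Mult.prems(4) by simp
    next
      case (Mult c x')
      then have eq: "c = z" "subst_star q (Prime p) = x' \<cdot> t"
        using Mult.prems(4) z by simp_all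
      from 2(2) eq(2) show ?thesis
      proof (rule Mult.IH[rotated 2])
        fix q' assume "q' \<in> star_words" "q = q' \<cdot> embed t" "x' = subst_star q' (Prime p)"
        then show thesis
          using Mult.prems(1)[of "Mult a q'"] 2 z eq Mult star_words_simps(3)[of "Prime z" q'] by simp
      next
        fix q' assume "q' \<in> star_words" "q = embed x' \<cdot> q'" "t = subst_star q' (Prime p)"
        then show thesis
          using Mult.prems(2)[of q'] 2 eq Mult by simp
      qed
    qed
  qed
qed

lemma trivial_mod_including:
  assumes q: "q \<in> star_words" and w: "\<lfloor>x \<cdot> \<lfloor>y\<rfloor>\<^sub>B\<rfloor>\<^sub>B = subst_star q \<lfloor>u \<cdot> \<lfloor>v\<rfloor>\<^sub>B\<rfloor>\<^sub>B"
  shows "trivial_mod plr_le (S_rbr lam) \<lfloor>x \<cdot> \<lfloor>y\<rfloor>\<^sub>B\<rfloor>\<^sub>B (rb_rel lam x y - subst_star_lin q (rb_rel lam u v))"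
proof -
  \<comment> \<open>The word has breadth 1, so \<open>q\<close> consists of one prime, which is the
    star or a bracket. The partial \<open>case\<close> expression names this prime.\<close>
  consider "q = star" | q1 where "q = \<lfloor>q1\<rfloor>\<^sub>B" "q1 \<in> star_words" "subst_star q1 \<lfloor>u \<cdot> \<lfloor>v\<rfloor>\<^sub>B\<rfloor>\<^sub>B = x \<cdot> \<lfloor>y\<rfloor>\<^sub>B"
    using q w
    by (cases q; (cases "case q of Prime p \<Rightarrow> p")?) (auto split: option.splits)
  then show ?thesis
  proof cases
    case 1
    then have "x = u" "y = v"
      using w by simp_all
    then show ?thesis
      by (auto simp: 1 subst_star_lin_star trivial_mod_def intro!: exI[of _ "[]"])
  next
    case (2 q1)
    from 2(2,3) show ?thesis
    proof (cases rule: subst_star_conc_cases)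
      case (left q')
      then show ?thesis
        using trivial_mod_left[of q' x u v lam y] 2 by simp
    next
      case (right q')
      then consider "q' = star" "y = u \<cdot> \<lfloor>v\<rfloor>\<^sub>B"
        | q2 where "q' = \<lfloor>q2\<rfloor>\<^sub>B" "q2 \<in> star_words" "y = subst_star q2 \<lfloor>u \<cdot> \<lfloor>v\<rfloor>\<^sub>B\<rfloor>\<^sub>B"
        by (cases q'; (cases "case q' of Prime p \<Rightarrow> p")?) (auto split: option.splits)
      then show ?thesis
      proof cases
        case 1
        then show ?thesis
          using trivial_mod_overlap[of lam x u v] right 2 by simp
      next
        case (2 q2)
        then show ?thesis
          using trivial_mod_right[of q2 y u v lam x] right \<open>q = \<lfloor>q1\<rfloor>\<^sub>B\<close> by simp
      qed
    qed
  qed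
qed

theorem groebner_shirshov_basis_S_rbr:
  fixes lam :: "'k::comm_ring_1"
  shows "groebner_shirshov_basis plr_le (S_rbr lam :: ('x::wellorder bword \<Rightarrow>\<^sub>0 'k) set)"
proof -
  have "monic plr_le (rb_rel lam x y)" for x y :: "'x bword"
    using lookup_rb_rel[of lam x y] by (auto simp: monic_def lead_rb_rel)
  moreover have "trivial_mod plr_le (S_rbr lam) w h"
    if "(w, h) \<in> including_compositions plr_le (rb_rel lam x y) (rb_rel lam u v)"
    for w h and x y u v :: "'x bword"
    using that by (auto simp: including_compositions_def lead_rb_rel intro: trivial_mod_including)
  moreover have "intersection_compositions plr_le (rb_rel lam x y) (rb_rel lam u v) = {}"
    for x y u v :: "'x bword"
    by (auto simp: intersection_compositions_def lead_rb_rel)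
  ultimately show ?thesis
    by (auto simp: groebner_shirshov_basis_def S_rbr_eq)
qed

section \<open>The normal form operator\<close>

text \<open>
  The restriction \<open>bdeg u = bdeg x\<close> is only there for the termination proof; all words in
  \<open>rb_op lam x\<close> satisfy it.
\<close>

function rb_op :: "'k::comm_ring_1 \<Rightarrow> 'x bword \<Rightarrow> ('x bword \<Rightarrow>\<^sub>0 'k)" where
  "rb_op lam (x \<cdot> \<lfloor>y\<rfloor>\<^sub>B) =
     word_mult (rb_op lam x) (basis_elem \<lfloor>y\<rfloor>\<^sub>B)
     - (\<Sum>u\<in>{u \<in> Poly_Mapping.keys (rb_op lam x). bdeg u = bdeg x}.
          scale (Poly_Mapping.lookup (rb_op lam x) u) (rb_op lam (u \<cdot> y)))
     - scale lam (rb_op lam (x \<cdot> y))"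
| "\<nexists>x y. w = x \<cdot> \<lfloor>y\<rfloor>\<^sub>B \<Longrightarrow> rb_op lam w = basis_elem \<lfloor>w\<rfloor>\<^sub>B"
  by (atomize_elim, auto)
termination
  \<comment> \<open>The degree drops for x. It is the same for u y and x y, but there the last
    factor has lost its bracket, which lowers \<open>last_len\<close>.\<close>
  by (relation "measures [\<lambda>(lam, w). bdeg w, \<lambda>(lam, w). last_len w]") auto

lemma keys_in_diff:
  "Poly_Mapping.keys f \<subseteq> A \<Longrightarrow> Poly_Mapping.keys g \<subseteq> A \<Longrightarrow> Poly_Mapping.keys (f - g) \<subseteq> A"
  using keys_diff[of f g] by blast

lemma keys_in_scale: "Poly_Mapping.keys f \<subseteq> A \<Longrightarrow> Poly_Mapping.keys (scale c f) \<subseteq> A"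
  by (metis in_keys_iff lookup_scale mult_zero_right subset_iff)

lemma keys_word_mult:
  assumes "\<And>u v. u \<in> Poly_Mapping.keys f \<Longrightarrow> v \<in> Poly_Mapping.keys g \<Longrightarrow> u \<cdot> v \<in> A"
  shows "Poly_Mapping.keys (word_mult f g) \<subseteq> A"
  unfolding word_mult_eq lin_ext_eq using assms by (intro keys_lin_lift) auto

text \<open>Each step of the recursion only moves or removes brackets, so the number of letters is
  kept. This discharges the degree restriction in the definition of \<open>rb_op\<close>.\<close>

lemma keys_rb_op: "Poly_Mapping.keys (rb_op lam w) \<subseteq> {u. bdeg u = bdeg w}"
proof (induction lam w rule: rb_op.induct)
  case (1 lam x y)
  show ?case
    unfolding rb_op.simps(1)
  proof (intro keys_in_diff keys_in_scale keys_word_mult)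
    show "Poly_Mapping.keys (\<Sum>u\<in>{u \<in> Poly_Mapping.keys (rb_op lam x). bdeg u = bdeg x}.
        scale (Poly_Mapping.lookup (rb_op lam x) u) (rb_op lam (u \<cdot> y))) \<subseteq> {u. bdeg u = bdeg (x \<cdot> \<lfloor>y\<rfloor>\<^sub>B)}"
      using 1 by (intro order.trans[OF keys_sum] UN_least keys_in_scale) auto
  qed (use 1 in auto)
next
  case (2 w lam)
  then show ?case by simp
qed

lemma rb_op_conc:
  "rb_op lam (x \<cdot> \<lfloor>y\<rfloor>\<^sub>B) = word_mult (rb_op lam x) (basis_elem \<lfloor>y\<rfloor>\<^sub>B)
     - lin_lift (rb_op lam) (word_mult (rb_op lam x) (basis_elem y)) - scale lam (rb_op lam (x \<cdot> y))"
proof -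
  have keys: "{u \<in> Poly_Mapping.keys (rb_op lam x). bdeg u = bdeg x} = Poly_Mapping.keys (rb_op lam x)"
    using keys_rb_op[of lam x] by auto
  have "lin_lift (rb_op lam) (word_mult f (basis_elem y)) = lin_lift (\<lambda>u. rb_op lam (u \<cdot> y)) f" for f
    by (induction f rule: basis_elem_induct) (simp_all add: word_mult_linear lin_lift_linear)
  then show ?thesis
    by (simp add: keys lin_lift_def)
qed

declare rb_op.simps(1) [simp del]

definition rb_op_lin :: "'k::comm_ring_1 \<Rightarrow> ('x bword \<Rightarrow>\<^sub>0 'k) \<Rightarrow> ('x bword \<Rightarrow>\<^sub>0 'k)" where
  "rb_op_lin lam = lin_lift (rb_op lam)"

interpretation rb_op_lin: module_hom scale scale
    "rb_op_lin lam :: ('x bword \<Rightarrow>\<^sub>0 'k::comm_ring_1) \<Rightarrow> ('x bword \<Rightarrow>\<^sub>0 'k)" for lam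
  unfolding rb_op_lin_def by (rule lin_lift.module_hom_axioms)

lemmas rb_op_lin_linear =
  rb_op_lin.add rb_op_lin.diff rb_op_lin.neg rb_op_lin.scale rb_op_lin.zero

lemma rb_op_lin_basis: "rb_op_lin lam (basis_elem w) = rb_op lam w"
  by (simp add: rb_op_lin_def)

lemma rb_op_lin_conc:
  "rb_op_lin lam (word_mult f (basis_elem \<lfloor>y\<rfloor>\<^sub>B)) = word_mult (rb_op_lin lam f) (basis_elem \<lfloor>y\<rfloor>\<^sub>B)
     - rb_op_lin lam (word_mult (rb_op_lin lam f) (basis_elem y)) - scale lam (rb_op_lin lam (word_mult f (basis_elem y)))"
proof (induction f rule: basis_elem_induct)
  case (basis x)
  show ?case
    using rb_op_conc[of lam x y] by (simp add: rb_op_lin_def)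
next
  case (scale c f)
  then show ?case
    by (simp add: word_mult_linear rb_op_lin_linear scale_linear mult.commute)
next
  case (add f g)
  show ?case
    unfolding word_mult_left.add rb_op_lin.add add by (simp add: scale_linear)
qed

text \<open>The second hypothesis covers all \<open>u\<close> of the degree of \<open>x\<close>
  because the recursion passes to u y for the monomials u of \<open>rb_op lam x\<close>, of which
  only the degree is known beforehand.\<close>

lemma rb_op_induct [case_names conc other]:
  assumes conc: "\<And>x y. (\<And>u. bdeg u < bdeg (x \<cdot> \<lfloor>y\<rfloor>\<^sub>B) \<Longrightarrow> P u) \<Longrightarrow>
      (\<And>u. bdeg u = bdeg x \<Longrightarrow> P (u \<cdot> y)) \<Longrightarrow> P (x \<cdot> \<lfloor>y\<rfloor>\<^sub>B)"
    and other: "\<And>w. \<nexists>x y. w = x \<cdot> \<lfloor>y\<rfloor>\<^sub>B \<Longrightarrow> P w"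
  shows "P w"
proof (induction w rule: wf_induct_rule[OF wf_measures, of "[bdeg, last_len]"])
  case (1 w)
  show ?case
  proof (cases "\<exists>x y. w = x \<cdot> \<lfloor>y\<rfloor>\<^sub>B")
    case True
    then obtain x y where "w = x \<cdot> \<lfloor>y\<rfloor>\<^sub>B" by blast
    with 1 show ?thesis by (auto intro!: conc)
  qed (auto intro: other)
qed

section \<open>The Rota-Baxter identity for the normal form operator\<close>

lemma linear_image_in:
  fixes F :: "('v \<Rightarrow>\<^sub>0 'k::comm_ring_1) \<Rightarrow> ('w \<Rightarrow>\<^sub>0 'k)"
  assumes "module_hom scale scale F" "scale.subspace I"
    and "\<And>v. v \<in> Poly_Mapping.keys g \<Longrightarrow> F (basis_elem v) \<in> I"
  shows "F g \<in> I"
proof -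
  interpret F: module_hom scale scale F by fact
  have "F g = F (\<Sum>u\<in>Poly_Mapping.keys g. scale (Poly_Mapping.lookup g u) (basis_elem u))"
    by (simp add: sum_scale_basis)
  also have "\<dots> \<in> I"
    using assms(2,3) by (simp add: F.sum F.scale scale.subspace_sum scale.subspace_scale)
  finally show ?thesis .
qed

text \<open>The failure of the Rota-Baxter identity as a bilinear expression. The operator is a
  parameter: for the bracket the defect lies in the ideal, for \<open>rb_op_lin\<close> it
  vanishes.\<close>

definition rb_defect ::
    "'k::comm_ring_1 \<Rightarrow> (('x bword \<Rightarrow>\<^sub>0 'k) \<Rightarrow> ('x bword \<Rightarrow>\<^sub>0 'k)) \<Rightarrow>
     ('x bword \<Rightarrow>\<^sub>0 'k) \<Rightarrow> ('x bword \<Rightarrow>\<^sub>0 'k) \<Rightarrow> ('x bword \<Rightarrow>\<^sub>0 'k)" where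
  "rb_defect lam P f g =
     P (word_mult f (P g)) + P (word_mult (P f) g) + scale lam (P (word_mult f g)) - word_mult (P f) (P g)"

lemma module_hom_rb_defect:
  assumes "module_hom scale scale P"
  shows "module_hom scale scale (rb_defect lam P f)" "module_hom scale scale (\<lambda>f. rb_defect lam P f g)"
proof -
  interpret P: module_hom scale scale P by fact
  show "module_hom scale scale (rb_defect lam P f)" "module_hom scale scale (\<lambda>f. rb_defect lam P f g)"
    by (unfold_locales; simp add: rb_defect_def word_mult_linear P.add P.scale scale_linear mult.commute)+
qed

lemma rb_defect_in:
  assumes "module_hom scale scale P" "scale.subspace I"
    and "\<And>u v. u \<in> Poly_Mapping.keys f \<Longrightarrow> v \<in> Poly_Mapping.keys g \<Longrightarrow>
      rb_defect lam P (basis_elem u) (basis_elem v) \<in> I"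
  shows "rb_defect lam P f g \<in> I"
  using assms(3) by (blast intro: linear_image_in[OF module_hom_rb_defect(1)[OF assms(1)] assms(2)]
      linear_image_in[OF module_hom_rb_defect(2)[OF assms(1)] assms(2)])

text \<open>The rule for P at a last factor [v] also applies to f u [v] and (P f) u [v]. Collecting
  terms, the defect obeys the recursion of P, except that the nested term splits in two, the defect
  being taken inside or outside; the terms P ((P f) (P u) v) of these two parts cancel.\<close>

lemma rb_defect_step:
  "rb_defect lam (rb_op_lin lam) f (basis_elem (u \<cdot> \<lfloor>v\<rfloor>\<^sub>B)) =
     word_mult (rb_defect lam (rb_op_lin lam) f (basis_elem u)) (basis_elem \<lfloor>v\<rfloor>\<^sub>B)
     - rb_op_lin lam (word_mult (rb_defect lam (rb_op_lin lam) f (basis_elem u)) (basis_elem v))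
     - rb_defect lam (rb_op_lin lam) f (word_mult (rb_op lam u) (basis_elem v))
     - scale lam (rb_defect lam (rb_op_lin lam) f (basis_elem (u \<cdot> v)))"
proof -
  have eq: "basis_elem (u \<cdot> \<lfloor>v\<rfloor>\<^sub>B) = word_mult (basis_elem u) (basis_elem \<lfloor>v\<rfloor>\<^sub>B)"
    "basis_elem (u \<cdot> v) = word_mult (basis_elem u) (basis_elem v)"
    "rb_op lam u = rb_op_lin lam (basis_elem u)"
    by (simp_all add: rb_op_lin_basis)
  show ?thesis
    unfolding eq rb_defect_def
    by (simp add: word_mult_linear rb_op_lin_linear scale_linear rb_op_lin_conc algebra_simps
        flip: word_mult_assoc del: word_mult_basis)
qed

lemma rb_defect_rb_op_basis: "rb_defect lam (rb_op_lin lam) f (basis_elem w) = 0"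
proof (induction w rule: rb_op_induct)
  case (conc u v)
  have "rb_defect lam (rb_op_lin lam) f (word_mult (rb_op lam u) (basis_elem v)) \<in> {0}"
  \<comment> \<open>The monomials of (P u) v are words t v with t of the degree of u, which is what
    the induction hypothesis covers.\<close>
  proof (rule linear_image_in[OF module_hom_rb_defect(1)[OF rb_op_lin.module_hom_axioms]])
    fix w assume "w \<in> Poly_Mapping.keys (word_mult (rb_op lam u) (basis_elem v))"
    moreover have "Poly_Mapping.keys (word_mult (rb_op lam u) (basis_elem v)) \<subseteq> {t \<cdot> v | t. bdeg t = bdeg u}"
      using keys_rb_op[of lam u] by (intro keys_word_mult) auto
    ultimately show "rb_defect lam (rb_op_lin lam) f (basis_elem w) \<in> {0}"
      using conc.IH(2) by blast
  qed simp
  moreover have "rb_defect lam (rb_op_lin lam) f (basis_elem u) = 0"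
    "rb_defect lam (rb_op_lin lam) f (basis_elem (u \<cdot> v)) = 0"
    using conc.IH by simp_all
  ultimately show ?case
    by (simp add: rb_defect_step word_mult_linear)
next
  case (other w)
  \<comment> \<open>Here P w is the plain bracket [w], and the Rota-Baxter identity for f and w is
    exactly the recursion of P at f [w].\<close>
  then have "rb_op_lin lam (basis_elem w) = basis_elem \<lfloor>w\<rfloor>\<^sub>B"
    by (simp add: rb_op_lin_basis)
  then show ?case
    by (simp add: rb_defect_def rb_op_lin_conc)
qed

lemma rb_defect_rb_op: "rb_defect lam (rb_op_lin lam) f g = 0"
  using linear_image_in[OF module_hom_rb_defect(1)[OF rb_op_lin.module_hom_axioms], of "{0}" g lam lam f]
  by (simp add: rb_defect_rb_op_basis)

section \<open>Irreducible words\<close>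

lemma Irr_rbr_iff: "w \<in> Irr_rbr \<longleftrightarrow> (\<forall>q\<in>star_words. \<forall>x y. w \<noteq> subst_star q \<lfloor>x \<cdot> \<lfloor>y\<rfloor>\<^sub>B\<rfloor>\<^sub>B)"
  by (auto simp: Irr_rbr_def)

lemma Irr_rbr_bracketD:
  assumes "\<lfloor>w\<rfloor>\<^sub>B \<in> Irr_rbr"
  shows "w \<in> Irr_rbr" "w \<noteq> x \<cdot> \<lfloor>y\<rfloor>\<^sub>B"
proof -
  show "w \<in> Irr_rbr"
    unfolding Irr_rbr_iff
  proof (intro ballI allI notI)
    fix q :: "'a option bword" and x y assume "q \<in> star_words" "w = subst_star q \<lfloor>x \<cdot> \<lfloor>y\<rfloor>\<^sub>B\<rfloor>\<^sub>B"
    then show False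
      using assms[unfolded Irr_rbr_iff, rule_format, of "\<lfloor>q\<rfloor>\<^sub>B" x y] by simp
  qed
  show "w \<noteq> x \<cdot> \<lfloor>y\<rfloor>\<^sub>B"
    using assms unfolding Irr_rbr_iff by (auto dest: bspec[of _ _ star])
qed

lemma Irr_rbr_bracketI:
  assumes "w \<in> Irr_rbr" "\<nexists>x y. w = x \<cdot> \<lfloor>y\<rfloor>\<^sub>B"
  shows "\<lfloor>w\<rfloor>\<^sub>B \<in> Irr_rbr"
  unfolding Irr_rbr_iff
proof (intro ballI allI notI)
  fix q :: "'a option bword" and x y assume "q \<in> star_words" "\<lfloor>w\<rfloor>\<^sub>B = subst_star q \<lfloor>x \<cdot> \<lfloor>y\<rfloor>\<^sub>B\<rfloor>\<^sub>B"
  then show False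
    using assms by (induction q rule: star_words_induct) (auto simp: Irr_rbr_iff)
qed

text \<open>A forbidden word is a single bracket, so inside a product it occurs within one of the
  factors.\<close>

lemma Irr_rbr_conc: "u \<cdot> v \<in> Irr_rbr \<longleftrightarrow> u \<in> Irr_rbr \<and> v \<in> Irr_rbr"
proof
  assume uv: "u \<cdot> v \<in> Irr_rbr"
  have "u \<noteq> subst_star q \<lfloor>x \<cdot> \<lfloor>y\<rfloor>\<^sub>B\<rfloor>\<^sub>B" "v \<noteq> subst_star q \<lfloor>x \<cdot> \<lfloor>y\<rfloor>\<^sub>B\<rfloor>\<^sub>B" if "q \<in> star_words" for q x y
    using uv[unfolded Irr_rbr_iff, rule_format, of "q \<cdot> embed v" x y]
      uv[unfolded Irr_rbr_iff, rule_format, of "embed u \<cdot> q" x y] that by auto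
  then show "u \<in> Irr_rbr \<and> v \<in> Irr_rbr"
    by (auto simp: Irr_rbr_iff)
next
  assume uv: "u \<in> Irr_rbr \<and> v \<in> Irr_rbr"
  show "u \<cdot> v \<in> Irr_rbr"
    unfolding Irr_rbr_iff
  proof (intro ballI allI notI)
    fix q :: "'a option bword" and x y
    assume "q \<in> star_words" "u \<cdot> v = subst_star q \<lfloor>x \<cdot> \<lfloor>y\<rfloor>\<^sub>B\<rfloor>\<^sub>B"
    from this(1) this(2)[symmetric] show False
      by (cases rule: subst_star_conc_cases) (use uv in \<open>unfold Irr_rbr_iff, blast\<close>)+
  qed
qed

text \<open>In the recursion y and [y] are again irreducible, and the monomials of
  \<open>rb_op lam x\<close> are so by induction; hence so are their products with y and with [y].
  The span of the irreducible words is thus stable under P.\<close>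

lemma keys_rb_op_Irr:
  "w \<in> Irr_rbr \<Longrightarrow> Poly_Mapping.keys (rb_op lam w) \<subseteq> Irr_rbr"
proof (induction w rule: rb_op_induct)
  case (conc x y)
  then have Irr: "x \<in> Irr_rbr" "y \<in> Irr_rbr" "\<lfloor>y\<rfloor>\<^sub>B \<in> Irr_rbr"
    by (auto simp: Irr_rbr_conc dest: Irr_rbr_bracketD)
  then have x: "Poly_Mapping.keys (rb_op lam x) \<subseteq> {u \<in> Irr_rbr. bdeg u = bdeg x}"
    using keys_rb_op[of lam x] conc.IH(1)[of x] by auto
  then have xy: "Poly_Mapping.keys (word_mult (rb_op lam x) (basis_elem y)) \<subseteq>
      {u \<cdot> y | u. u \<in> Irr_rbr \<and> bdeg u = bdeg x}"
    by (intro keys_word_mult) auto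
  show ?case
    unfolding rb_op_conc
  proof (intro keys_in_diff keys_in_scale keys_lin_lift)
    show "Poly_Mapping.keys (word_mult (rb_op lam x) (basis_elem \<lfloor>y\<rfloor>\<^sub>B)) \<subseteq> Irr_rbr"
      using x Irr by (intro keys_word_mult) (auto simp: Irr_rbr_conc)
    show "Poly_Mapping.keys (rb_op lam (x \<cdot> y)) \<subseteq> Irr_rbr"
      using conc.IH(2)[of x] Irr by (simp add: Irr_rbr_conc)
    fix u assume "u \<in> Poly_Mapping.keys (word_mult (rb_op lam x) (basis_elem y))"
    then show "Poly_Mapping.keys (rb_op lam u) \<subseteq> Irr_rbr"
      using xy conc.IH(2) Irr by (fastforce simp: Irr_rbr_conc)
  qed
next
  case (other w)
  then show ?case by (auto intro: Irr_rbr_bracketI)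
qed

lemma letter_in_Irr: "Prime (Letter x) \<in> Irr_rbr"
  unfolding Irr_rbr_iff
proof (intro ballI allI notI)
  fix q :: "'a option bword" and u v
  assume "q \<in> star_words" "Prime (Letter x) = subst_star q \<lfloor>u \<cdot> \<lfloor>v\<rfloor>\<^sub>B\<rfloor>\<^sub>B"
  then show False
    by (induction q rule: star_words_induct) simp_all
qed

section \<open>Quotients and the universal property\<close>

lemma word_algebra_simps [simp]:
  "carrier word_algebra = UNIV" "x \<otimes>\<^bsub>word_algebra\<^esub> y = word_mult x y"
  "\<zero>\<^bsub>word_algebra\<^esub> = 0" "x \<oplus>\<^bsub>word_algebra\<^esub> y = x + y" "c \<odot>\<^bsub>word_algebra\<^esub> x = scale c x"
  "oper word_algebra = lin_ext bracket"
  by (simp_all add: word_algebra_def)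

lemma ring_of_type_algebra_simps [simp]:
  "carrier ring_of_type_algebra = UNIV" "a \<otimes>\<^bsub>ring_of_type_algebra\<^esub> b = a * b"
  "a \<oplus>\<^bsub>ring_of_type_algebra\<^esub> b = a + b" "\<one>\<^bsub>ring_of_type_algebra\<^esub> = 1" "\<zero>\<^bsub>ring_of_type_algebra\<^esub> = 0"
  by (simp_all add: ring_of_type_algebra_def)

lemma nonunitary_operated_algebraI:
  fixes A :: "('k::comm_ring_1, 'a, 'm) operated_algebra_scheme" (structure)
  assumes "abelian_group A"
    and "\<And>c x. x \<in> carrier A \<Longrightarrow> c \<odot> x \<in> carrier A"
    and "\<And>c d x. x \<in> carrier A \<Longrightarrow> (c + d) \<odot> x = c \<odot> x \<oplus> d \<odot> x"
    and "\<And>c x y. x \<in> carrier A \<Longrightarrow> y \<in> carrier A \<Longrightarrow> c \<odot> (x \<oplus> y) = c \<odot> x \<oplus> c \<odot> y"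
    and "\<And>c d x. x \<in> carrier A \<Longrightarrow> (c * d) \<odot> x = c \<odot> (d \<odot> x)"
    and "\<And>x. x \<in> carrier A \<Longrightarrow> 1 \<odot> x = x"
    and "nonunitary_operated_algebra_axioms A"
  shows "nonunitary_operated_algebra A"
  using assms by (intro nonunitary_operated_algebra.intro moduleI cring_from_type_algebra) simp_all

text \<open>The operator is a parameter so that the free operated algebra and the model with
  operator P are covered at once.\<close>

lemma nonunitary_operated_algebra_word_algebra:
  assumes "module_hom scale scale F"
  shows "nonunitary_operated_algebra
    (word_algebra\<lparr>oper := F\<rparr> :: ('k::comm_ring_1, 'x bword \<Rightarrow>\<^sub>0 'k) operated_algebra)"
proof -
  interpret F: module_hom scale scale F by fact
  show ?thesis
  proof (rule nonunitary_operated_algebraI)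
    show "abelian_group (word_algebra\<lparr>oper := F\<rparr>)"
      by (rule abelian_groupI) (auto simp: algebra_simps intro: exI[of _ "- _"] left_minus)
    show "nonunitary_operated_algebra_axioms (word_algebra\<lparr>oper := F\<rparr>)"
      by unfold_locales (simp_all add: word_mult_linear word_mult_assoc F.add F.scale)
  qed (simp_all add: scale_linear scale.scale_left_distrib)
qed

lemma word_algebra_update: "word_algebra\<lparr>oper := lin_ext bracket\<rparr> = word_algebra"
  by (simp add: word_algebra_def)

interpretation W: nonunitary_operated_algebra
    "word_algebra :: ('k::comm_ring_1, 'x bword \<Rightarrow>\<^sub>0 'k) operated_algebra"
  using nonunitary_operated_algebra_word_algebra[OF lin_ext.module_hom_axioms]
  by (metis word_algebra_update)

lemma a_inv_word_algebra [simp]: "\<ominus>\<^bsub>word_algebra\<^esub> x = - x"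
  by (rule W.minus_equality) simp_all

section \<open>Evaluation of words in an operated algebra\<close>

primrec eval_word :: "('k, 'a, 'm) operated_algebra_scheme \<Rightarrow> ('x \<Rightarrow> 'a) \<Rightarrow> 'x bword \<Rightarrow> 'a"
  and eval_prime :: "('k, 'a, 'm) operated_algebra_scheme \<Rightarrow> ('x \<Rightarrow> 'a) \<Rightarrow> 'x bprime \<Rightarrow> 'a" where
  "eval_word A f (Prime p) = eval_prime A f p"
| "eval_word A f (Mult p w) = eval_prime A f p \<otimes>\<^bsub>A\<^esub> eval_word A f w"
| "eval_prime A f (Letter x) = f x"
| "eval_prime A f (Bracket w) = oper A (eval_word A f w)"

lemma eval_word_Prime_conc [simp]:
  "eval_word A f (Prime p \<cdot> w) = eval_prime A f p \<otimes>\<^bsub>A\<^esub> eval_word A f w"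
  unfolding conc.simps(1) by (rule eval_word.simps)

definition word_hom :: "('k::comm_ring_1, 'a, 'm) operated_algebra_scheme \<Rightarrow> ('x \<Rightarrow> 'a) \<Rightarrow> ('x bword \<Rightarrow>\<^sub>0 'k) \<Rightarrow> 'a" where
  "word_hom A f F = (\<Oplus>\<^bsub>A\<^esub>u\<in>Poly_Mapping.keys F. Poly_Mapping.lookup F u \<odot>\<^bsub>A\<^esub> eval_word A f u)"

lemma operated_hom_comp:
  "g \<in> operated_hom A B \<Longrightarrow> h \<in> operated_hom B C \<Longrightarrow> (\<lambda>x. h (g x)) \<in> operated_hom A C"
  by (auto simp: operated_hom_def Pi_iff)

locale letter_assignment = nonunitary_operated_algebra A
  for A :: "('k::comm_ring_1, 'a, 'm) operated_algebra_scheme" (structure) and f :: "'x \<Rightarrow> 'a" +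
  assumes f_closed: "f x \<in> carrier A"
begin

lemma smult_in_carrier [simp]: "x \<in> carrier A \<Longrightarrow> c \<odot> x \<in> carrier A"
  using smult_closed[of c x] by simp

lemma eval_word_closed [simp]: "eval_word A f w \<in> carrier A"
  by (rule bword.induct[of "\<lambda>p. eval_prime A f p \<in> carrier A"])
    (simp_all add: f_closed mult_closed oper_closed)

lemma eval_prime_closed [simp]: "eval_prime A f p \<in> carrier A"
  using eval_word_closed[of "Prime p"] by simp

lemma word_hom_closed [simp]: "word_hom A f F \<in> carrier A"
  unfolding word_hom_def by (rule finsum_closed) auto

lemma eval_word_conc: "eval_word A f (u \<cdot> v) = eval_word A f u \<otimes> eval_word A f v"
  by (induction u rule: bword_list_induct) (simp_all add: mult_assoc)

lemma word_hom_superset: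
  assumes "finite S" "Poly_Mapping.keys F \<subseteq> S"
  shows "word_hom A f F = (\<Oplus>u\<in>S. Poly_Mapping.lookup F u \<odot> eval_word A f u)"
  unfolding word_hom_def using assms
  by (intro add.finprod_mono_neutral_cong_left) (auto simp: in_keys_iff smult_l_null[simplified])

lemma word_hom_add: "word_hom A f (F + G) = word_hom A f F \<oplus> word_hom A f G"
proof -
  let ?S = "Poly_Mapping.keys F \<union> Poly_Mapping.keys G"
  have "word_hom A f (F + G) = (\<Oplus>u\<in>?S. Poly_Mapping.lookup (F + G) u \<odot> eval_word A f u)"
    by (rule word_hom_superset) (auto dest: keys_add[THEN subsetD])
  also have "\<dots> = (\<Oplus>u\<in>?S. Poly_Mapping.lookup F u \<odot> eval_word A f u \<oplus> Poly_Mapping.lookup G u \<odot> eval_word A f u)"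
    by (intro finsum_cong') (auto simp: lookup_add smult_l_distr[simplified])
  also have "\<dots> = word_hom A f F \<oplus> word_hom A f G"
    by (subst finsum_addf) (auto simp flip: word_hom_superset)
  finally show ?thesis .
qed

lemma word_hom_basis [simp]: "word_hom A f (basis_elem w) = eval_word A f w"
  by (simp add: word_hom_def smult_one[simplified])

lemma word_hom_scale: "word_hom A f (scale c F) = c \<odot> word_hom A f F"
proof -
  have "word_hom A f (scale c F) = (\<Oplus>u\<in>Poly_Mapping.keys F. c \<odot> (Poly_Mapping.lookup F u \<odot> eval_word A f u))"
    by (subst word_hom_superset[of "Poly_Mapping.keys F"])
      (auto simp: in_keys_iff smult_assoc1[simplified] intro!: finsum_cong')
  also have "\<dots> = c \<odot> word_hom A f F"
    unfolding word_hom_def by (subst finsum_smult_ldistr) auto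
  finally show ?thesis .
qed

lemma word_hom_mult: "word_hom A f (word_mult F G) = word_hom A f F \<otimes> word_hom A f G"
proof (induction F rule: basis_elem_induct)
  case (basis u)
  show ?case
  proof (induction G rule: basis_elem_induct)
    case (basis v)
    show ?case by (simp add: eval_word_conc)
  qed (simp_all add: word_mult_linear word_hom_add word_hom_scale mult_distr_right smult_mult_right)
qed (simp_all add: word_mult_linear word_hom_add word_hom_scale mult_distr_left smult_mult_left)

lemma word_hom_oper: "word_hom A f (lin_ext bracket F) = oper A (word_hom A f F)"
  by (induction F rule: basis_elem_induct)
    (simp_all add: lin_ext_linear word_hom_add word_hom_scale oper_add oper_smult)

lemma word_hom_zero: "word_hom A f 0 = \<zero>"
  by (simp add: word_hom_def)

lemma word_hom_unique:
  assumes "h \<in> operated_hom word_algebra A" "\<And>x. h (basis_elem (Prime (Letter x))) = f x"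
  shows "h F = word_hom A f F"
proof -
  have "h (basis_elem w) = eval_word A f w" for w
  proof (rule bword.induct[of "\<lambda>p. h (basis_elem (Prime p)) = eval_prime A f p"])
    fix p w
    assume *: "h (basis_elem (Prime p)) = eval_prime A f p" "h (basis_elem w) = eval_word A f w"
    have "h (basis_elem (Prime p \<cdot> w)) = h (basis_elem (Prime p)) \<otimes> h (basis_elem w)"
      using assms(1) by (auto simp: operated_hom_def simp flip: word_mult_basis)
    then show "h (basis_elem (Mult p w)) = eval_word A f (Mult p w)"
      using * eval_word_conc[of "Prime p" w] by simp
  next
    fix w assume "h (basis_elem w) = eval_word A f w"
    moreover have "h (lin_ext bracket (basis_elem w)) = oper A (h (basis_elem w))"
      using assms(1) by (auto simp: operated_hom_def simp del: lin_ext_basis)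
    ultimately show "h (basis_elem \<lfloor>w\<rfloor>\<^sub>B) = eval_prime A f (Bracket w)"
      by simp
  qed (simp_all add: assms(2))
  with assms(1) show ?thesis
    by (induction F rule: basis_elem_induct) (simp_all add: word_hom_add word_hom_scale operated_hom_def)
qed

end

section \<open>Quotients of the word algebra by operated ideals\<close>

locale word_ideal =
  fixes I :: "('x bword \<Rightarrow>\<^sub>0 'k::comm_ring_1) set"
  assumes ideal: "operated_ideal I word_algebra"
begin

lemma subspace: "scale.subspace I"
proof -
  interpret submodule I "ring_of_type_algebra :: 'k ring"
      "word_algebra :: ('k, 'x bword \<Rightarrow>\<^sub>0 'k) operated_algebra"
    using ideal by (simp add: operated_ideal_def)
  show ?thesis
    using one_closed m_closed smult_closed by (auto simp: scale.subspace_def)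
qed

lemmas closed = scale.subspace_0[OF subspace] scale.subspace_add[OF subspace]
  scale.subspace_diff[OF subspace] scale.subspace_neg[OF subspace] scale.subspace_scale[OF subspace]

lemma mult_left: "x \<in> I \<Longrightarrow> word_mult a x \<in> I" and mult_right: "x \<in> I \<Longrightarrow> word_mult x a \<in> I"
  and oper: "x \<in> I \<Longrightarrow> lin_ext bracket x \<in> I"
  using ideal by (auto simp: operated_ideal_def)

definition cls :: "('x bword \<Rightarrow>\<^sub>0 'k) \<Rightarrow> ('x bword \<Rightarrow>\<^sub>0 'k) set" where
  "cls a = I +>\<^bsub>word_algebra :: ('k, 'x bword \<Rightarrow>\<^sub>0 'k) operated_algebra\<^esub> a"

abbreviation Q :: "('k, ('x bword \<Rightarrow>\<^sub>0 'k) set) operated_algebra" where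
  "Q \<equiv> quotient_operated_algebra word_algebra I"

lemma mem_cls: "b \<in> cls a \<longleftrightarrow> b - a \<in> I"
  by (auto simp: cls_def a_r_coset_def' intro: bexI[of _ "b - a"])

lemma cls_eq_iff: "cls a = cls b \<longleftrightarrow> a - b \<in> I"
proof
  assume "cls a = cls b"
  then show "a - b \<in> I"
    using mem_cls[of a a] mem_cls[of a b] closed(1) by simp
next
  assume *: "a - b \<in> I"
  have "x - a \<in> I \<longleftrightarrow> x - b \<in> I" for x
    using closed(2)[OF _ *, of "x - a"] closed(3)[OF _ *, of "x - b"] by auto
  then show "cls a = cls b"
    by (auto simp: mem_cls)
qed

lemma cls_self: "a \<in> cls a"
  by (simp add: mem_cls closed(1))

text \<open>The quotient operations are unions over all representatives; once the result does not
  depend on the representative, the union collapses to one class.\<close>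

lemma UN_cls: "(\<And>b. b - a \<in> I \<Longrightarrow> g b = g a) \<Longrightarrow> (\<Union>b\<in>cls a. g b) = g a"
  by (rule UN_constant_eq[OF cls_self]) (simp add: mem_cls)

lemma carrier_Q: "carrier Q = range cls"
  by (auto simp: quotient_operated_algebra_def FactRing_def A_RCOSETS_def' cls_def)

lemma cls_in_Q [simp]: "cls a \<in> carrier Q"
  by (simp add: carrier_Q)

lemma add_Q [simp]: "cls a \<oplus>\<^bsub>Q\<^esub> cls b = cls (a + b)"
proof -
  have "x \<in> cls a <+>\<^bsub>word_algebra\<^esub> cls b \<longleftrightarrow> x \<in> cls (a + b)" for x
  proof
    assume "x \<in> cls a <+>\<^bsub>word_algebra\<^esub> cls b"
    then obtain y z where "x = y + z" "y - a \<in> I" "z - b \<in> I"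
      by (auto simp: set_add_def' mem_cls)
    then show "x \<in> cls (a + b)"
      using closed(2)[of "y - a" "z - b"] by (simp add: mem_cls algebra_simps)
  next
    assume "x \<in> cls (a + b)"
    then have "x = a + (x - a)" "x - a \<in> cls b"
      by (auto simp: mem_cls algebra_simps)
    then show "x \<in> cls a <+>\<^bsub>word_algebra\<^esub> cls b"
      using cls_self[of a] by (force simp: set_add_def')
  qed
  then show ?thesis
    by (auto simp: quotient_operated_algebra_def FactRing_def)
qed

lemma mult_Q [simp]: "cls a \<otimes>\<^bsub>Q\<^esub> cls b = cls (word_mult a b)"
proof -
  have "(\<Union>y\<in>cls b. cls (word_mult x y)) = cls (word_mult x b)" for x
    by (rule UN_cls) (simp add: cls_eq_iff mult_left flip: word_mult_right.diff)
  moreover have "(\<Union>x\<in>cls a. cls (word_mult x b)) = cls (word_mult a b)"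
    by (rule UN_cls) (simp add: cls_eq_iff mult_right flip: word_mult_left.diff)
  ultimately have "(\<Union>x\<in>cls a. \<Union>y\<in>cls b. cls (word_mult x y)) = cls (word_mult a b)"
    by simp
  then show ?thesis
    by (simp add: quotient_operated_algebra_def FactRing_def rcoset_mult_def flip: cls_def)
qed

lemma zero_Q: "\<zero>\<^bsub>Q\<^esub> = cls 0"
  by (auto simp: quotient_operated_algebra_def FactRing_def mem_cls)

lemma smult_Q [simp]: "c \<odot>\<^bsub>Q\<^esub> cls a = cls (scale c a)"
proof -
  have "(\<Union>x\<in>cls a. cls (scale c x)) = cls (scale c a)"
    by (rule UN_cls) (simp add: cls_eq_iff closed flip: scale.scale_right_diff_distrib)
  then show ?thesis
    by (simp add: quotient_operated_algebra_def flip: cls_def)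
qed

lemma oper_Q [simp]: "oper Q (cls a) = cls (lin_ext bracket a)"
proof -
  have "(\<Union>x\<in>cls a. cls (lin_ext bracket x)) = cls (lin_ext bracket a)"
    by (rule UN_cls) (simp add: cls_eq_iff oper flip: lin_ext.diff)
  then show ?thesis
    by (simp add: quotient_operated_algebra_def flip: cls_def)
qed

lemma nonunitary_operated_algebra_Q: "nonunitary_operated_algebra Q"
proof (rule nonunitary_operated_algebraI)
  show "abelian_group Q"
  proof (rule abelian_groupI)
    fix x assume "x \<in> carrier Q"
    then obtain a where "x = cls a" by (auto simp: carrier_Q)
    then show "\<exists>y\<in>carrier Q. y \<oplus>\<^bsub>Q\<^esub> x = \<zero>\<^bsub>Q\<^esub>"
      by (intro bexI[of _ "cls (- a)"]) (simp_all add: zero_Q)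
  qed (auto simp: carrier_Q zero_Q algebra_simps)
  show "nonunitary_operated_algebra_axioms Q"
    by unfold_locales
      (auto simp: carrier_Q word_mult_linear word_mult_assoc lin_ext_linear)
qed (auto simp: carrier_Q scale_linear scale.scale_left_distrib)

lemma cls_operated_hom: "cls \<in> operated_hom word_algebra Q"
  by (simp add: operated_hom_def)

lemma finsum_cls: "finite S \<Longrightarrow> (\<Oplus>\<^bsub>Q\<^esub>i\<in>S. cls (g i)) = cls (\<Sum>i\<in>S. g i)"
proof (induction S rule: finite_induct)
  case empty
  interpret nonunitary_operated_algebra Q by (rule nonunitary_operated_algebra_Q)
  show ?case by (simp add: zero_Q)
next
  case (insert i S)
  interpret nonunitary_operated_algebra Q by (rule nonunitary_operated_algebra_Q)
  from insert show ?case by simp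
qed

text \<open>A coefficient family on words is itself an element of the word algebra, so the basis
  property becomes a statement about single classes.\<close>

lemma linear_combination_cls:
  "(\<Oplus>\<^bsub>Q\<^esub>i\<in>Poly_Mapping.keys c. Poly_Mapping.lookup c i \<odot>\<^bsub>Q\<^esub> cls (basis_elem i)) = cls c"
  by (simp add: finsum_cls sum_scale_basis)

end

lemma operated_idealI:
  fixes I :: "('x bword \<Rightarrow>\<^sub>0 'k::comm_ring_1) set"
  assumes "scale.subspace I" "\<And>x a. x \<in> I \<Longrightarrow> word_mult x a \<in> I" "\<And>x a. x \<in> I \<Longrightarrow> word_mult a x \<in> I"
    "\<And>x. x \<in> I \<Longrightarrow> lin_ext bracket x \<in> I"
  shows "operated_ideal I word_algebra"
  using assms
  by (auto simp: operated_ideal_def scale.subspace_def scale.subspace_neg intro!: W.submoduleI)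

section \<open>The universal property of the Rota-Baxter quotient\<close>

interpretation rbr: word_ideal "Id_rbr lam :: ('x bword \<Rightarrow>\<^sub>0 'k::comm_ring_1) set" for lam
proof
  have *: "word_ideal J" if "operated_ideal J word_algebra" for J :: "('x bword \<Rightarrow>\<^sub>0 'k) set"
    using that by unfold_locales
  show "operated_ideal (Id_rbr lam :: ('x bword \<Rightarrow>\<^sub>0 'k) set) word_algebra"
    unfolding Id_rbr_def operated_ideal_gen_def
    by (rule operated_idealI)
      (auto intro!: scale.subspace_Inter intro: word_ideal.subspace[OF *] word_ideal.mult_left[OF *]
        word_ideal.mult_right[OF *] word_ideal.oper[OF *])
qed

lemma rb_rel_in_Id: "rb_rel lam x y \<in> Id_rbr lam"
  by (auto simp: Id_rbr_def operated_ideal_gen_def S_rbr_eq)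

lemma Id_rbr_least: "operated_ideal J word_algebra \<Longrightarrow> (\<And>x y. rb_rel lam x y \<in> J) \<Longrightarrow> Id_rbr lam \<subseteq> J"
  by (auto simp: Id_rbr_def operated_ideal_gen_def S_rbr_eq)

lemma rbr_quotient_eq: "rbr_quotient lam = rbr.Q lam"
  by (simp add: rbr_quotient_def)

lemma rbr_class_eq: "rbr_class lam w = rbr.cls lam (basis_elem w)"
  by (simp add: rbr_class_def rbr.cls_def)

lemma rb_defect_in_Id: "rb_defect lam (lin_ext bracket) f g \<in> Id_rbr lam"
proof (rule rb_defect_in[OF lin_ext.module_hom_axioms rbr.subspace])
  fix u v :: "'x bword"
  show "rb_defect lam (lin_ext bracket) (basis_elem u) (basis_elem v) \<in> Id_rbr lam"
    using rb_rel_in_Id[of lam u v] by (simp add: rb_defect_def rb_rel_def)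
qed

lemma nonunitary_rota_baxter_algebra_rbr:
  fixes lam :: "'k::comm_ring_1"
  shows "nonunitary_rota_baxter_algebra lam (rbr.Q lam :: ('k, ('x bword \<Rightarrow>\<^sub>0 'k) set) operated_algebra)"
proof (intro nonunitary_rota_baxter_algebra.intro rbr.nonunitary_operated_algebra_Q, unfold_locales)
  fix x y :: "('x bword \<Rightarrow>\<^sub>0 'k) set"
  assume "x \<in> carrier (rbr.Q lam)" "y \<in> carrier (rbr.Q lam)"
  then obtain a b where "x = rbr.cls lam a" "y = rbr.cls lam b"
    by (auto simp: rbr.carrier_Q)
  then show "oper (rbr.Q lam) x \<otimes>\<^bsub>rbr.Q lam\<^esub> oper (rbr.Q lam) y =
      oper (rbr.Q lam) (oper (rbr.Q lam) x \<otimes>\<^bsub>rbr.Q lam\<^esub> y) \<oplus>\<^bsub>rbr.Q lam\<^esub>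
      oper (rbr.Q lam) (x \<otimes>\<^bsub>rbr.Q lam\<^esub> oper (rbr.Q lam) y) \<oplus>\<^bsub>rbr.Q lam\<^esub>
      lam \<odot>\<^bsub>rbr.Q lam\<^esub> oper (rbr.Q lam) (x \<otimes>\<^bsub>rbr.Q lam\<^esub> y)"
    using rbr.closed(4)[OF rb_defect_in_Id[of lam a b]]
    by (simp add: rbr.cls_eq_iff rb_defect_def algebra_simps)
qed

locale rota_baxter_assignment =
  nonunitary_rota_baxter_algebra lam A + letter_assignment A f
  for lam :: "'k::comm_ring_1" and A :: "('k, 'a, 'm) operated_algebra_scheme" (structure) and f :: "'x \<Rightarrow> 'a"
begin

lemma word_hom_Id_rbr:
  assumes "F \<in> Id_rbr lam"
  shows "word_hom A f F = \<zero>"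
proof -
  \<comment> \<open>Zero is 0 times any element, so homogeneity of the product gives absorption; the
    operator is treated likewise below.\<close>
  have zero_mult: "\<zero> \<otimes> x = \<zero>" "x \<otimes> \<zero> = \<zero>" if "x \<in> carrier A" for x
    using smult_mult_left[of x x 0] smult_mult_right[of x x 0] that
    by (simp_all add: smult_l_null[simplified] mult_closed)
  have oper_zero: "oper A \<zero> = \<zero>"
    using oper_smult[of "\<zero>" 0] by (simp add: smult_l_null[simplified] oper_closed)
  have rb: "rb_rel lam x y \<in> {F. word_hom A f F = \<zero>}" for x y
  proof -
    let ?x = "eval_word A f x" and ?y = "eval_word A f y"
    \<comment> \<open>The negative monomial is moved to the other side, so that additivity of the
      evaluation and cancellation in the group of \<open>A\<close> suffice.\<close>
    have "rb_rel lam x y + basis_elem (\<lfloor>x\<rfloor>\<^sub>B \<cdot> \<lfloor>y\<rfloor>\<^sub>B) =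
        basis_elem \<lfloor>\<lfloor>x\<rfloor>\<^sub>B \<cdot> y\<rfloor>\<^sub>B + basis_elem \<lfloor>x \<cdot> \<lfloor>y\<rfloor>\<^sub>B\<rfloor>\<^sub>B + scale lam (basis_elem \<lfloor>x \<cdot> y\<rfloor>\<^sub>B)"
      by (simp add: rb_rel_def)
    then have "word_hom A f (rb_rel lam x y) \<oplus> oper A ?x \<otimes> oper A ?y = oper A ?x \<otimes> oper A ?y"
      using word_hom_add[of "rb_rel lam x y" "basis_elem (\<lfloor>x\<rfloor>\<^sub>B \<cdot> \<lfloor>y\<rfloor>\<^sub>B)"]
      by (simp add: word_hom_add word_hom_scale eval_word_conc rota_baxter)
    then show ?thesis
      by (simp add: mult_closed oper_closed)
  qed
  have "operated_ideal {F. word_hom A f F = \<zero>} word_algebra"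
    by (rule operated_idealI)
      (auto simp: scale.subspace_def word_hom_add word_hom_scale word_hom_mult word_hom_oper word_hom_zero zero_mult oper_zero
        smult_r_null[simplified])
  from Id_rbr_least[OF this rb] assms show ?thesis
    by blast
qed

lemma word_hom_cong:
  assumes "F - G \<in> Id_rbr lam"
  shows "word_hom A f F = word_hom A f G"
  using word_hom_add[of "F - G" G] word_hom_Id_rbr[OF assms] by simp

lemma rbr_universal:
  "\<exists>h\<in>operated_hom (rbr.Q lam) A. (\<forall>x. h (rbr_class lam (Prime (Letter x))) = f x) \<and>
     (\<forall>h'\<in>operated_hom (rbr.Q lam) A. (\<forall>x. h' (rbr_class lam (Prime (Letter x))) = f x) \<longrightarrow>
       (\<forall>a\<in>carrier (rbr.Q lam). h' a = h a))"
proof (intro bexI[of _ "\<lambda>C. word_hom A f (SOME a. a \<in> C)"] conjI ballI impI allI)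
  \<comment> \<open>The induced map evaluates a chosen representative; two representatives differ by
    an element of the ideal, on which evaluation vanishes.\<close>
  have eval_some: "word_hom A f (SOME a. a \<in> rbr.cls lam F) = word_hom A f F" for F
    using someI[of "\<lambda>a. a \<in> rbr.cls lam F", OF rbr.cls_self]
    by (auto simp: rbr.mem_cls intro: word_hom_cong)
  show "(\<lambda>C. word_hom A f (SOME a. a \<in> C)) \<in> operated_hom (rbr.Q lam) A"
    by (auto simp: operated_hom_def rbr.carrier_Q eval_some word_hom_add word_hom_mult word_hom_scale word_hom_oper)
  show "word_hom A f (SOME a. a \<in> rbr_class lam (Prime (Letter x))) = f x" for x
    by (simp add: rbr_class_eq eval_some)
  fix h' and C :: "('x bword \<Rightarrow>\<^sub>0 'k) set"
  assume h': "h' \<in> operated_hom (rbr.Q lam) A" "\<forall>x. h' (rbr_class lam (Prime (Letter x))) = f x"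
    and "C \<in> carrier (rbr.Q lam)"
  then obtain F where C: "C = rbr.cls lam F"
    by (auto simp: rbr.carrier_Q)
  have hom: "(\<lambda>F. h' (rbr.cls lam F)) \<in> operated_hom word_algebra A"
    using rbr.cls_operated_hom h'(1) by (rule operated_hom_comp)
  show "h' C = word_hom A f (SOME a. a \<in> C)"
    using word_hom_unique[OF hom, of F] h'(2) by (simp add: C eval_some rbr_class_eq)
qed

end

theorem free_rbr_quotient:
  "free_nonunitary_rota_baxter_algebra TYPE('b) lam (rbr_quotient lam) (\<lambda>x. rbr_class lam (Prime (Letter x)))"
  unfolding free_nonunitary_rota_baxter_algebra_def rbr_quotient_eq
proof (intro conjI allI impI nonunitary_rota_baxter_algebra_rbr)
  show "rbr_class lam (Prime (Letter x)) \<in> carrier (rbr.Q lam)" for x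
    by (simp add: rbr_class_eq)
  fix B :: "('a, 'b) operated_algebra" and f :: "'c \<Rightarrow> 'b"
  assume "nonunitary_rota_baxter_algebra lam B \<and> (\<forall>x. f x \<in> carrier B)"
  then interpret rota_baxter_assignment lam B f
    by (simp add: rota_baxter_assignment_def letter_assignment_def letter_assignment_axioms_def
        nonunitary_rota_baxter_algebra_def)
  show "\<exists>h\<in>operated_hom (rbr.Q lam) B. (\<forall>x. h (rbr_class lam (Prime (Letter x))) = f x) \<and>
     (\<forall>h'\<in>operated_hom (rbr.Q lam) B. (\<forall>x. h' (rbr_class lam (Prime (Letter x))) = f x) \<longrightarrow>
       (\<forall>a\<in>carrier (rbr.Q lam). h' a = h a))"
    by (rule rbr_universal)
qed

section \<open>Normal forms\<close>

abbreviation normal_algebra :: "'k::comm_ring_1 \<Rightarrow> ('k, 'x bword \<Rightarrow>\<^sub>0 'k) operated_algebra" where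
  "normal_algebra lam \<equiv> word_algebra\<lparr>oper := rb_op_lin lam\<rparr>"

text \<open>With every letter assigned to itself, the model provides
  \<open>normal.word_hom_Id_rbr\<close>: evaluation in it kills the ideal.\<close>

interpretation normal: rota_baxter_assignment lam
    "normal_algebra lam :: ('k::comm_ring_1, 'x bword \<Rightarrow>\<^sub>0 'k) operated_algebra"
    "\<lambda>x. basis_elem (Prime (Letter x))" for lam
proof -
  interpret nonunitary_operated_algebra "normal_algebra lam :: ('k, 'x bword \<Rightarrow>\<^sub>0 'k) operated_algebra"
    by (rule nonunitary_operated_algebra_word_algebra) (rule rb_op_lin.module_hom_axioms)
  show "rota_baxter_assignment lam (normal_algebra lam :: ('k, 'x bword \<Rightarrow>\<^sub>0 'k) operated_algebra)
      (\<lambda>x. basis_elem (Prime (Letter x)))"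
  proof unfold_locales
    fix x y :: "'x bword \<Rightarrow>\<^sub>0 'k"
    show "oper (normal_algebra lam) x \<otimes>\<^bsub>normal_algebra lam\<^esub> oper (normal_algebra lam) y =
      oper (normal_algebra lam) (oper (normal_algebra lam) x \<otimes>\<^bsub>normal_algebra lam\<^esub> y) \<oplus>\<^bsub>normal_algebra lam\<^esub>
      oper (normal_algebra lam) (x \<otimes>\<^bsub>normal_algebra lam\<^esub> oper (normal_algebra lam) y) \<oplus>\<^bsub>normal_algebra lam\<^esub>
      lam \<odot>\<^bsub>normal_algebra lam\<^esub> oper (normal_algebra lam) (x \<otimes>\<^bsub>normal_algebra lam\<^esub> y)"
      using rb_defect_rb_op[of lam x y] by (simp add: rb_defect_def algebra_simps)
  qed simp
qed

text \<open>Evaluates every bracket of a word by P. The facts below make it the projection onto the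
  span of the irreducible words along the ideal.\<close>

definition nf :: "'k::comm_ring_1 \<Rightarrow> ('x bword \<Rightarrow>\<^sub>0 'k) \<Rightarrow> ('x bword \<Rightarrow>\<^sub>0 'k)" where
  "nf lam = word_hom (normal_algebra lam) (\<lambda>x. basis_elem (Prime (Letter x)))"

interpretation nf: module_hom scale scale
    "nf lam :: ('x bword \<Rightarrow>\<^sub>0 'k::comm_ring_1) \<Rightarrow> ('x bword \<Rightarrow>\<^sub>0 'k)" for lam
  by unfold_locales (simp_all add: nf_def normal.word_hom_add normal.word_hom_scale)

lemma nf_basis_simps:
  "nf lam (basis_elem (Prime (Letter x))) = basis_elem (Prime (Letter x))"
  "nf lam (basis_elem \<lfloor>w\<rfloor>\<^sub>B) = rb_op_lin lam (nf lam (basis_elem w))"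
  "nf lam (basis_elem (u \<cdot> v)) = word_mult (nf lam (basis_elem u)) (nf lam (basis_elem v))"
  by (simp_all add: nf_def normal.eval_word_conc)

lemma bword_conc_induct [case_names Letter Bracket conc]:
  assumes "\<And>x. P (Prime (Letter x))" "\<And>w. P w \<Longrightarrow> P \<lfloor>w\<rfloor>\<^sub>B" "\<And>u v. P u \<Longrightarrow> P v \<Longrightarrow> P (u \<cdot> v)"
  shows "P w"
  by (rule bword.induct[of "\<lambda>p. P (Prime p)"]) (use assms in auto)

text \<open>The content of an irreducible bracket does not have the form x [y], so P takes its
  default value there, the bracket itself.\<close>

lemma nf_Irr: "w \<in> Irr_rbr \<Longrightarrow> nf lam (basis_elem w) = basis_elem w"
proof (induction w rule: bword_conc_induct)
  case (Bracket w)
  then have "w \<in> Irr_rbr" "\<nexists>x y. w = x \<cdot> \<lfloor>y\<rfloor>\<^sub>B"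
    by (auto dest: Irr_rbr_bracketD)
  with Bracket.IH show ?case
    by (simp add: nf_basis_simps rb_op_lin_basis)
qed (simp_all add: nf_basis_simps Irr_rbr_conc)

lemma keys_nf_basis: "Poly_Mapping.keys (nf lam (basis_elem w)) \<subseteq> Irr_rbr"
proof (induction w rule: bword_conc_induct)
  case (Bracket w)
  then show ?case
    unfolding nf_basis_simps rb_op_lin_def by (intro keys_lin_lift keys_rb_op_Irr) auto
next
  case (conc u v)
  then show ?case
    unfolding nf_basis_simps by (intro keys_word_mult) (auto simp: Irr_rbr_conc)
qed (simp add: nf_basis_simps letter_in_Irr)

lemma keys_nf: "Poly_Mapping.keys (nf lam F) \<subseteq> Irr_rbr"
proof -
  have "nf lam F = lin_lift (\<lambda>w. nf lam (basis_elem w)) F"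
    by (induction F rule: basis_elem_induct) (simp_all add: nf.add nf.scale lin_lift_linear)
  then show ?thesis
    by (simp add: keys_lin_lift keys_nf_basis)
qed

lemma nf_fixes: "Poly_Mapping.keys F \<subseteq> Irr_rbr \<Longrightarrow> nf lam F = F"
  using nf.sum[of lam "\<lambda>u. scale (Poly_Mapping.lookup F u) (basis_elem u)" "Poly_Mapping.keys F"]
  by (auto simp: sum_scale_basis nf.scale nf_Irr subset_iff)

lemma module_hom_diff_bracket: "module_hom scale scale (\<lambda>F. lin_ext bracket F - rb_op_lin lam F)"
  by unfold_locales (simp_all add: lin_ext_linear rb_op_lin_linear scale_linear)

lemma bracket_rb_op: "lin_ext bracket (basis_elem w) - rb_op_lin lam (basis_elem w) \<in> Id_rbr lam"
proof (induction w rule: rb_op_induct)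
  case (conc x y)
  let ?G = "word_mult (rb_op lam x) (basis_elem y)" and ?d = "\<lambda>F. lin_ext bracket F - rb_op_lin lam F"
  have "?d ?G \<in> Id_rbr lam"
  proof (rule linear_image_in[OF module_hom_diff_bracket rbr.subspace])
    fix v assume "v \<in> Poly_Mapping.keys ?G"
    moreover have "Poly_Mapping.keys ?G \<subseteq> {u \<cdot> y | u. bdeg u = bdeg x}"
      using keys_rb_op[of lam x] by (intro keys_word_mult) auto
    ultimately show "?d (basis_elem v) \<in> Id_rbr lam"
      using conc.IH(2) by blast
  qed
  moreover have "?d (basis_elem x) \<in> Id_rbr lam" "?d (basis_elem (x \<cdot> y)) \<in> Id_rbr lam"
    using conc.IH by simp_all
  \<comment> \<open>Starting from the relation, the brackets are replaced by P one at a time, inner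
    ones first. Each replacement costs one term with a difference \<open>?d\<close>, which lies in
    the ideal by induction.\<close>
  moreover have "?d (basis_elem (x \<cdot> \<lfloor>y\<rfloor>\<^sub>B)) = rb_rel lam x y
      + word_mult (?d (basis_elem x)) (basis_elem \<lfloor>y\<rfloor>\<^sub>B)
      - lin_ext bracket (word_mult (?d (basis_elem x)) (basis_elem y))
      - ?d ?G - scale lam (?d (basis_elem (x \<cdot> y)))"
    by (simp add: rb_rel_def rb_op_lin_basis rb_op_conc rb_op_lin_def[symmetric] word_mult_linear
        lin_ext_linear scale_linear algebra_simps)
  ultimately show ?case
    by (simp add: rbr.closed rb_rel_in_Id rbr.mult_right rbr.oper)
qed (simp add: rb_op_lin_basis rbr.closed)

lemma basis_nf_in_Id: "basis_elem w - nf lam (basis_elem w) \<in> Id_rbr lam"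
proof (induction w rule: bword_conc_induct)
  case (Bracket w)
  let ?N = "nf lam (basis_elem w)"
  have "basis_elem \<lfloor>w\<rfloor>\<^sub>B - nf lam (basis_elem \<lfloor>w\<rfloor>\<^sub>B) =
      lin_ext bracket (basis_elem w - ?N) + (lin_ext bracket ?N - rb_op_lin lam ?N)"
    by (simp add: nf_basis_simps lin_ext_linear)
  moreover have "lin_ext bracket ?N - rb_op_lin lam ?N \<in> Id_rbr lam"
    by (rule linear_image_in[OF module_hom_diff_bracket rbr.subspace]) (rule bracket_rb_op)
  ultimately show ?case
    using Bracket by (simp add: rbr.closed rbr.oper)
next
  case (conc u v)
  have "basis_elem (u \<cdot> v) - nf lam (basis_elem (u \<cdot> v)) =
      word_mult (basis_elem u - nf lam (basis_elem u)) (basis_elem v)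
      + word_mult (nf lam (basis_elem u)) (basis_elem v - nf lam (basis_elem v))"
    by (simp add: nf_basis_simps word_mult_linear)
  then show ?case
    using conc by (simp add: rbr.closed rbr.mult_left rbr.mult_right)
qed (simp add: nf_basis_simps rbr.closed)

lemma nf_in_Id: "F - nf lam F \<in> Id_rbr lam"
proof (rule linear_image_in[where F = "\<lambda>F. F - nf lam F", OF _ rbr.subspace])
  show "module_hom scale scale (\<lambda>F. F - nf lam F)"
    by unfold_locales (simp_all add: nf.add nf.scale scale_linear)
qed (rule basis_nf_in_Id)

theorem module_basis_rbr_quotient: "module_basis (rbr_quotient lam) (rbr_class lam) Irr_rbr"
  unfolding module_basis_def rbr_quotient_eq rbr_class_eq rbr.linear_combination_cls
proof (intro conjI ballI allI impI)
  fix m assume "m \<in> carrier (rbr.Q lam)"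
  then obtain F where "m = rbr.cls lam F"
    by (auto simp: rbr.carrier_Q)
  \<comment> \<open>The normal form of \<open>F\<close> is itself the family of
    coefficients.\<close>
  then show "\<exists>c. Poly_Mapping.keys c \<subseteq> Irr_rbr \<and> m = rbr.cls lam c"
    using nf_in_Id[of F lam] keys_nf[of lam F] by (auto simp: rbr.cls_eq_iff)
next
  fix c assume "Poly_Mapping.keys c \<subseteq> Irr_rbr" "rbr.cls lam c = \<zero>\<^bsub>rbr.Q lam\<^esub>"
  moreover from this have "nf lam c = 0"
    by (simp add: nf_def normal.word_hom_Id_rbr rbr.zero_Q rbr.cls_eq_iff)
  ultimately show "c = 0"
    by (simp add: nf_fixes)
qed simp

theorem theorem4p4:
  fixes lam :: "'k::{comm_ring_1, ring_char_0}"
  shows "groebner_shirshov_basis plr_le (S_rbr lam :: ('x::wellorder bword \<Rightarrow>\<^sub>0 'k) set) \<and>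
    free_nonunitary_rota_baxter_algebra TYPE('b) lam
      (rbr_quotient lam :: ('k, ('x bword \<Rightarrow>\<^sub>0 'k) set) operated_algebra)
      (\<lambda>x. rbr_class lam (Prime (Letter x))) \<and>
    module_basis (rbr_quotient lam :: ('k, ('x bword \<Rightarrow>\<^sub>0 'k) set) operated_algebra)
      (rbr_class lam) Irr_rbr"
  using groebner_shirshov_basis_S_rbr[of lam] free_rbr_quotient[of lam] module_basis_rbr_quotient[of lam]
  by blast

end
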